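(* Let $\varepsilon\in\{1,-1\}$, let $r\ge0$ and $m\ge1$ be integers, let $a,b,c_0,\lambda\in\mathbb{C}$, and put $M=m+\lambda$. Assume $\operatorname{Re}M>0$, $c_0\notin\{0,-1,-2,\ldots\}$ and $\operatorname{Re}(c_0-a-b)>-1$. Then $$\varepsilon(M+1-a)(M+1-b)\,\Psi_{m,r,\varepsilon}=M(M+1-c_0)\,\Psi_{m-1,r,\varepsilon}+rM\,\Psi_{m-1,r-1,\varepsilon}+E_{\varepsilon,r}(M;a,b,c_0),$$ where the term containing $\Psi_{m-1,-1,\varepsilon}$ is omitted when $r=0$ and all $\Psi$-terms are evaluated at $(\lambda;a,b,c_0)$. In the case $\varepsilon=1$, if moreover $c_0-a-b+1,\ c_0-a,\ c_0-b\notin\{0,-1,-2,\ldots\}$, then $$E_{+,r}(a,b,c_0)=(-1)^r\frac{\Gamma(c_0)\Gamma(c_0-a-b+1)}{\Gamma(c_0-a)\Gamma(c_0-b)}\,\mathcal B_r\bigl(\Delta_1(a,b;c_0),\ldots,\Delta_r(a,b;c_0)\bigr).$$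
   Context: Notation: $(u)_0=1$, $(u)_n=u(u+1)\cdots(u+n-1)$. The complete exponential Bell polynomials $\mathcal B_r$ are defined by $\exp\bigl(\sum_{j\ge1}x_j\frac{t^j}{j!}\bigr)=\sum_{r\ge0}\mathcal B_r(x_1,\ldots,x_r)\frac{t^r}{r!}$, $\mathcal B_0=1$. The shifted harmonic numbers are $H_n^{(s)}(c_0)=\sum_{k=0}^{n-1}\frac1{(c_0+k)^s}$, $H_0^{(s)}(c_0)=0$, and $$\mathcal H_r(n;c_0)=\mathcal B_r\bigl(H_n^{(1)}(c_0),1!\,H_n^{(2)}(c_0),\ldots,(r-1)!\,H_n^{(r)}(c_0)\bigr).$$ The harmonic moments are $$\Psi_{m,r,\varepsilon}(\lambda;a,b,c_0)=\sum_{n=0}^{\infty}\frac{\varepsilon^n(a)_n(b)_n}{(c_0)_n n!}\,\frac{\mathcal H_r(n;c_0)}{n+m+1+\lambda}.$$ Define $$E_{\varepsilon,r}(M;a,b,c_0)=(-1)^r\left.\frac{\partial^r}{\partial c^r}E_\varepsilon(M;a,b,c)\right|_{c=c_0},$$ where for $\varepsilon=1$, $E_+(M;a,b,c)=E_+(a,b,c)=\frac{\Gamma(c)\Gamma(c-a-b+1)}{\Gamma(c-a)\Gamma(c-b)}$ (independent of $M$, so $E_{+,r}$ is written $E_{+,r}(a,b,c_0)$; $1/\Gamma(z)=0$ at non-positive integers $z$), and for $\varepsilon=-1$, $$E_-(M;a,b,c)=(c+a+b-2M-2)\,{}_2F_1(a,b;c;-1)-2\left.\frac{d}{dz}{}_2F_1(a,b;c;z)\right|_{z=-1},$$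 with ${}_2F_1(a,b;c;z)$ the Gauss hypergeometric function continued analytically to $\mathbb{C}\setminus[1,\infty)$ (principal branch). Finally, with $\psi=\Gamma'/\Gamma$ and $\psi^{(k)}$ its $k$-th derivative, $$\Delta_j(a,b;c_0)=\psi^{(j-1)}(c_0)+\psi^{(j-1)}(c_0-a-b+1)-\psi^{(j-1)}(c_0-a)-\psi^{(j-1)}(c_0-b).$$ *)

theory Defs
  imports "HOL-Complex_Analysis.Complex_Analysis"
begin

unbundle fps_syntax

text \<open>
  The Bell polynomials are evaluated at a whole sequence \<open>x\<close>, of which only the entries
  \<open>x 1, \<dots>, x r\<close> matter for \<open>bell_complete r x\<close>; \<open>x 0\<close> is ignored. The definition is the exponential
  generating function identity, read as an identity of formal power series
  (\<open>F oo G\<close> is the composition \<open>F(G(t))\<close>).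
\<close>

definition bell_complete :: "nat \<Rightarrow> (nat \<Rightarrow> complex) \<Rightarrow> complex" where
  "bell_complete r x =
     fact r * (fps_exp 1 oo Abs_fps (\<lambda>j. if j = 0 then 0 else x j / fact j)) $ r"

definition shifted_harmonic :: "nat \<Rightarrow> nat \<Rightarrow> complex \<Rightarrow> complex" where
  "shifted_harmonic s n c0 = (\<Sum>k<n. 1 / (c0 + of_nat k) ^ s)"

definition harmonic_bell :: "nat \<Rightarrow> nat \<Rightarrow> complex \<Rightarrow> complex" where
  "harmonic_bell r n c0 = bell_complete r (\<lambda>j. fact (j - 1) * shifted_harmonic j n c0)"

definition harmonic_moment_term ::
  "nat \<Rightarrow> nat \<Rightarrow> complex \<Rightarrow> complex \<Rightarrow> complex \<Rightarrow> complex \<Rightarrow> complex \<Rightarrow> nat \<Rightarrow> complex" where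
  "harmonic_moment_term m r \<epsilon> lam a b c0 n =
     \<epsilon> ^ n * pochhammer a n * pochhammer b n / (pochhammer c0 n * fact n) *
       (harmonic_bell r n c0 / (of_nat n + of_nat m + 1 + lam))"

definition harmonic_moment ::
  "nat \<Rightarrow> nat \<Rightarrow> complex \<Rightarrow> complex \<Rightarrow> complex \<Rightarrow> complex \<Rightarrow> complex \<Rightarrow> complex" where
  "harmonic_moment m r \<epsilon> lam a b c0 = (\<Sum>n. harmonic_moment_term m r \<epsilon> lam a b c0 n)"

text \<open>
  The principal branch of the Gauss function: the analytic continuation of the hypergeometric
  series from the unit disc to the plane slit along \<open>[1, \<infinity>)\<close>. By the identity theorem the
  choice operator picks a function that is uniquely determined on the slit plane; the values on
  the slit are unspecified.
\<close>

definition slit_plane :: "complex set" where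
  "slit_plane = UNIV - complex_of_real ` {1..}"

definition hyp2F1 :: "complex \<Rightarrow> complex \<Rightarrow> complex \<Rightarrow> complex \<Rightarrow> complex" where
  "hyp2F1 a b c = (SOME f. f holomorphic_on slit_plane \<and>
     (\<forall>z\<in>ball 0 1. (\<lambda>n. pochhammer a n * pochhammer b n / (pochhammer c n * fact n) * z ^ n)
                      sums f z))"

text \<open>
  \<open>rGamma\<close> is the entire function \<open>1 / \<Gamma>\<close>, which vanishes at the non-positive integers.
\<close>

definition E_plus :: "complex \<Rightarrow> complex \<Rightarrow> complex \<Rightarrow> complex" where
  "E_plus a b c = Gamma c * Gamma (c - a - b + 1) * rGamma (c - a) * rGamma (c - b)"

definition E_minus :: "complex \<Rightarrow> complex \<Rightarrow> complex \<Rightarrow> complex \<Rightarrow> complex" where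
  "E_minus M a b c =
     (c + a + b - 2 * M - 2) * hyp2F1 a b c (-1) - 2 * deriv (hyp2F1 a b c) (-1)"

text \<open>Only \<open>\<epsilon> = 1\<close> and \<open>\<epsilon> = -1\<close> are meaningful below.\<close>

definition E_fun :: "complex \<Rightarrow> complex \<Rightarrow> complex \<Rightarrow> complex \<Rightarrow> complex \<Rightarrow> complex" where
  "E_fun \<epsilon> M a b c = (if \<epsilon> = 1 then E_plus a b c else E_minus M a b c)"

definition E_deriv ::
  "complex \<Rightarrow> nat \<Rightarrow> complex \<Rightarrow> complex \<Rightarrow> complex \<Rightarrow> complex \<Rightarrow> complex" where
  "E_deriv \<epsilon> r M a b c0 = (-1) ^ r * (deriv ^^ r) (\<lambda>c. E_fun \<epsilon> M a b c) c0"

text \<open>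
  \<open>Polygamma k\<close> is the \<open>k\<close>-th derivative of the digamma function. Only indices \<open>j \<ge> 1\<close> are used.
\<close>

definition Delta_psi :: "nat \<Rightarrow> complex \<Rightarrow> complex \<Rightarrow> complex \<Rightarrow> complex" where
  "Delta_psi j a b c0 =
     Polygamma (j - 1) c0 + Polygamma (j - 1) (c0 - a - b + 1)
       - Polygamma (j - 1) (c0 - a) - Polygamma (j - 1) (c0 - b)"

end

theory Submission
  imports Defs
begin

text \<open>
  Everything is obtained from the case \<open>r = 0\<close> by differentiating \<open>r\<close> times in \<open>c\<close>. The
  logarithmic derivative of \<open>1 / (c)\<^sub>n\<close> is \<open>- H\<^sub>n\<^sup>(\<^sup>1\<^sup>)(c)\<close>, and a function with logarithmic derivative
  \<open>L\<close> has \<open>r\<close>-th derivative \<open>f \<cdot> B\<^sub>r(L, L', L'', \<dots>)\<close> (\<open>higher_deriv_log_derivative\<close>). Hence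
  \<open>(-1)\<^sup>r \<partial>\<^sup>r\<close> turns \<open>1 / (c)\<^sub>n\<close> into \<open>harmonic_bell r n c / (c)\<^sub>n\<close>, and it turns the plain moment
  \<open>F\<^sub>M(c) = \<Sum>n. \<epsilon>\<^sup>n (a)\<^sub>n (b)\<^sub>n / ((c)\<^sub>n n! (n + M))\<close> into a harmonic moment. Differentiation under the
  sum is legitimate because the series converges locally uniformly in \<open>c\<close> on the domain
  \<open>Re (c - a - b) > -1\<close>, \<open>c\<close> not a non-positive integer (\<open>moment_series_uniform_limit\<close>). The
  factor \<open>M + 1 - c\<close> in front of \<open>F\<^sub>M\<close> is linear in \<open>c\<close>, so the Leibniz rule leaves a single extra
  term: this is the term with \<open>r - 1\<close>. The same formula for higher derivatives, applied to the
  quotient of Gamma functions, gives the closed form of the \<open>r\<close>-th derivative of \<open>E_plus\<close>.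

  The case \<open>r = 0\<close> reads
  \<open>\<epsilon> (M+1-a) (M+1-b) F\<^sub>M\<^sub>+\<^sub>1(c) = M (M+1-c) F\<^sub>M(c) + E\<close>. The ratio of consecutive coefficients of
  the Gauss series is \<open>(n+a)(n+b) / ((n+c)(n+1))\<close>; dividing \<open>(n+a)(n+b)\<close> by \<open>n+M+1\<close> and
  \<open>n(n+c-1)\<close> by \<open>n+M\<close> with remainder shows that \<open>z (M+1-a) (M+1-b) F\<^sub>M\<^sub>+\<^sub>1 - M (M+1-c) F\<^sub>M\<close>, summed
  up to \<open>N\<close> with weights \<open>z\<^sup>n\<close>, equals a sum of coefficients times linear polynomials in
  \<open>n\<close> (\<open>moment_telescoping\<close>). It remains to evaluate that sum.

  For \<open>\<epsilon> = 1\<close> it is \<open>N u\<^sub>N + (c-a-b) \<Sum>n<N. u\<^sub>n\<close> up to a null sequence, where \<open>u\<^sub>n\<close> are the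
  coefficients. By telescoping once more this is \<open>(c-a)(c-b)/c\<close> times a partial sum of the Gauss
  series at \<open>1\<close> with \<open>c\<close> replaced by \<open>c + 1\<close>, which converges on the whole domain, and Gauss's
  summation theorem gives its limit. That theorem is proved in the classical way: the telescoped
  relation connects the sums at \<open>c\<close> and \<open>c + 1\<close>, the sum at \<open>c + N\<close> tends to \<open>1\<close>, and the
  resulting ratio of Pochhammer symbols tends to the ratio of Gamma functions by Euler's limit.

  For \<open>\<epsilon> = -1\<close> the sum need not converge at \<open>z = -1\<close>. Inside the unit disc it is a combination of
  the Gauss function and its derivative, and both sides are continuous up to \<open>z = -1\<close>: the moments
  because they converge absolutely, the Gauss function because it is holomorphic there.

  The last point requires the continuation of the Gauss series to the slit plane to exist
  (\<open>hypergeometric_continuation\<close>). The substitution \<open>z = 4 w / (1 + w)\<^sup>2\<close> maps the unit disc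
  conformally onto the slit plane and sends the singular points \<open>1\<close> and \<open>\<infinity>\<close> to the unit circle.
  In the variable \<open>w\<close> the hypergeometric equation is a first-order system for \<open>f\<close> and \<open>z f'\<close>
  whose only singularity in the disc is the regular one at \<open>0\<close>; its power series solution
  therefore converges in the whole disc, and pulled back to \<open>z\<close> it has the Gauss coefficients.
\<close>

section \<open>Complete Bell polynomials and higher derivatives\<close>

lemma bell_complete_0 [simp]: "bell_complete 0 x = 1"
  by (simp add: bell_complete_def fps_compose_nth)

text \<open>
  The derivative of \<open>exp G\<close> is \<open>exp G \<cdot> G'\<close>; this is its coefficient of \<open>t\<^sup>r\<close>. It is the recursion
  satisfied by the derivatives of a function with prescribed logarithmic derivative.
\<close>
lemma bell_complete_Suc:
  "bell_complete (Suc r) x =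
     (\<Sum>i\<le>r. of_nat (r choose i) * bell_complete i x * x (Suc (r - i)))"
proof -
  define G where "G = Abs_fps (\<lambda>j. if j = 0 then 0 else x j / fact j)"
  define F where "F = fps_exp 1 oo G"
  have F: "bell_complete i x = fact i * F $ i" for i
    by (simp add: bell_complete_def F_def G_def)
  have "fps_deriv F = F * fps_deriv G"
    unfolding F_def by (subst fps_compose_deriv) (simp_all add: G_def)
  hence "fps_deriv F $ r = (\<Sum>i\<le>r. F $ i * (fps_deriv G) $ (r - i))"
    by (simp add: fps_mult_nth atLeast0AtMost)
  also have "\<dots> = (\<Sum>i\<le>r. F $ i * (x (Suc (r - i)) / fact (r - i)))"
    by (intro sum.cong refl) (simp add: G_def field_simps del: of_nat_Suc)
  finally have "fact r * fps_deriv F $ r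
      = (\<Sum>i\<le>r. fact r * (F $ i * (x (Suc (r - i)) / fact (r - i))))"
    by (simp add: sum_distrib_left)
  also have "\<dots> = (\<Sum>i\<le>r. of_nat (r choose i) * bell_complete i x * x (Suc (r - i)))"
    by (intro sum.cong refl) (simp add: F binomial_fact field_simps)
  also have "fact r * fps_deriv F $ r = bell_complete (Suc r) x"
    by (simp add: F)
  finally show ?thesis .
qed

lemma bell_complete_cong:
  assumes "\<And>j. 0 < j \<Longrightarrow> x j = y j"
  shows "bell_complete r x = bell_complete r y"
proof (induction r rule: less_induct)
  case (less r)
  show ?case
  proof (cases r)
    case (Suc s)
    show ?thesis unfolding Suc bell_complete_Suc
      by (intro sum.cong refl) (simp add: less.IH Suc assms)
  qed simp
qed

text \<open>
  Bell polynomials are isobaric: \<open>x j\<close> has weight \<open>j\<close>.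
\<close>
lemma bell_complete_scale:
  "bell_complete r (\<lambda>j. s ^ j * x j) = s ^ r * bell_complete r x"
proof (induction r rule: less_induct)
  case (less r)
  show ?case
  proof (cases r)
    case (Suc t)
    have *: "s ^ i * s ^ Suc (t - i) = s ^ Suc t" if "i \<le> t" for i
      using that by (simp flip: power_add)
    show ?thesis unfolding Suc bell_complete_Suc sum_distrib_left
    proof (intro sum.cong refl, goal_cases)
      case (1 i)
      hence "i \<le> t" by simp
      hence IH: "bell_complete i (\<lambda>j. s ^ j * x j) = s ^ i * bell_complete i x"
        by (intro less.IH) (simp add: Suc)
      show ?case
        unfolding IH *[OF \<open>i \<le> t\<close>, symmetric] by (simp only: mult_ac)
    qed
  qed simp
qed

text \<open>
  The family \<open>L\<close> consists of the logarithmic derivative \<open>L 0\<close> of \<open>f\<close> and its successive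
  derivatives. By the Leibniz rule for \<open>f' = f \<cdot> L 0\<close>, the quotients of the derivatives of \<open>f\<close>
  by \<open>f\<close> obey the recursion of the Bell polynomials.
\<close>
lemma higher_deriv_log_derivative:
  assumes S: "open S" "z \<in> S"
    and f: "\<And>w. w \<in> S \<Longrightarrow> (f has_field_derivative f w * L 0 w) (at w)"
    and L: "\<And>j w. w \<in> S \<Longrightarrow> (L j has_field_derivative L (Suc j) w) (at w)"
  shows "(deriv ^^ r) f z = f z * bell_complete r (\<lambda>j. L (j - 1) z)"
  using S(2)
proof (induction r arbitrary: z rule: less_induct)
  case (less r)
  have holf: "f holomorphic_on S"
    using f S(1) holomorphic_on_open by blast
  have holL: "L j holomorphic_on S" for j
    using L S(1) holomorphic_on_open by blast
  have dL: "(deriv ^^ j) (L 0) w = L j w" if "w \<in> S" for j w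
    using that
  proof (induction j arbitrary: w)
    case (Suc j)
    have "deriv ((deriv ^^ j) (L 0)) w = deriv (L j) w"
      using Suc holL by (intro complex_derivative_transform_within_open[OF _ _ S(1)])
        (auto intro!: holomorphic_higher_deriv S)
    then show ?case using L[OF Suc.prems] by (simp add: DERIV_imp_deriv)
  qed simp
  show ?case
  proof (cases r)
    case (Suc s)
    have "(deriv ^^ r) f z = (deriv ^^ s) (deriv f) z"
      by (simp add: Suc funpow_Suc_right del: funpow.simps)
    also have "\<dots> = (deriv ^^ s) (\<lambda>w. f w * L 0 w) z"
      using f by (intro higher_deriv_transform_within_open[OF _ _ S(1) less.prems])
        (auto intro!: holomorphic_intros holf holL S DERIV_imp_deriv)
    also have "\<dots> = (\<Sum>i\<le>s. of_nat (s choose i) * (deriv ^^ i) f z * L (s - i) z)"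
      by (subst higher_deriv_mult[OF holf holL S(1) less.prems])
        (simp add: dL less.prems atLeast0AtMost)
    also have "\<dots> = f z * bell_complete r (\<lambda>j. L (j - 1) z)"
      unfolding Suc bell_complete_Suc sum_distrib_left
      by (intro sum.cong refl) (simp add: less.IH less.prems Suc algebra_simps)
    finally show ?thesis .
  qed simp
qed

text \<open>
  The harmonic weights are the higher derivatives of \<open>1 / (c)\<^sub>n\<close>: the derivatives of its
  logarithmic derivative \<open>- (\<Sum>k<n. 1 / (c + k))\<close> are harmonic sums up to factorials and signs,
  and the signs add up to \<open>(-1)\<^sup>r\<close> because Bell polynomials are isobaric.
\<close>
lemma higher_deriv_inverse_pochhammer:
  assumes c: "c \<notin> \<int>\<^sub>\<le>\<^sub>0"
  shows "(-1) ^ r * (deriv ^^ r) (\<lambda>c. 1 / pochhammer c n) c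
           = harmonic_bell r n c / pochhammer c n"
proof -
  let ?S = "- \<int>\<^sub>\<le>\<^sub>0 :: complex set"
  define L where "L j w = (\<Sum>k<n. (-1) ^ Suc j * fact j / (w + of_nat k) ^ Suc j)" for j and w :: complex
  have nz: "w + of_nat k \<noteq> 0" if "w \<in> ?S" for w :: complex and k
    using that by (metis ComplD add_eq_0_iff2 minus_of_nat_in_nonpos_Ints)
  have S: "open ?S" using closed_nonpos_Ints by (simp add: open_Compl)
  have alg: "(-1) ^ Suc j * fact j * (- (inverse (v ^ Suc j) * (of_nat (Suc j) * v ^ j) * inverse (v ^ Suc j)))
      = (-1) ^ Suc (Suc j) * fact (Suc j) / v ^ Suc (Suc j)" if "v \<noteq> 0" for v :: complex and j
    using that by (simp add: field_simps)
  have dL: "(L j has_field_derivative L (Suc j) w) (at w)" if "w \<in> ?S" for j w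
    unfolding L_def
  proof (rule DERIV_sum)
    fix k
    have "((\<lambda>w. (-1) ^ Suc j * fact j * inverse ((w + of_nat k) ^ Suc j)) has_field_derivative
        (-1) ^ Suc j * fact j * (- (inverse ((w + of_nat k) ^ Suc j)
          * (of_nat (Suc j) * (w + of_nat k) ^ j) * inverse ((w + of_nat k) ^ Suc j)))) (at w)"
    proof (intro DERIV_cmult DERIV_inverse')
      have "((\<lambda>w. w + of_nat k) has_field_derivative 1) (at w)"
        by (auto intro!: derivative_eq_intros)
      from DERIV_power_Suc[OF this, of j]
      show "((\<lambda>w. (w + of_nat k) ^ Suc j) has_field_derivative
          of_nat (Suc j) * (w + of_nat k) ^ j) (at w)" by simp
    qed (use nz[OF that] in simp)
    also have "(-1) ^ Suc j * fact j * (- (inverse ((w + of_nat k) ^ Suc j)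
          * (of_nat (Suc j) * (w + of_nat k) ^ j) * inverse ((w + of_nat k) ^ Suc j)))
        = (-1) ^ Suc (Suc j) * fact (Suc j) / (w + of_nat k) ^ Suc (Suc j)"
      by (rule alg) (rule nz[OF that])
    finally show "((\<lambda>w. (-1) ^ Suc j * fact j / (w + of_nat k) ^ Suc j) has_field_derivative
        (-1) ^ Suc (Suc j) * fact (Suc j) / (w + of_nat k) ^ Suc (Suc j)) (at w)"
      by (simp add: divide_inverse)
  qed
  have split: "1 / p * s * (1 / v) + - 1 / v\<^sup>2 * (1 / p) = 1 / (p * v) * (s + - 1 / v)"
    if "v \<noteq> 0" "p \<noteq> 0" for p s v :: complex
    using that by (simp add: field_simps power2_eq_square)
  have df: "((\<lambda>c. 1 / pochhammer c n) has_field_derivative 1 / pochhammer w n * L 0 w) (at w)"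
    if w: "w \<in> ?S" for w
  proof -
    have "((\<lambda>c. 1 / pochhammer c n) has_field_derivative
        1 / pochhammer w n * (\<Sum>k<n. - 1 / (w + of_nat k))) (at w)"
    proof (induction n)
      case (Suc n)
      have p: "pochhammer w n \<noteq> 0"
        using nz[OF w] by (auto simp: pochhammer_prod)
      have "((\<lambda>c. 1 / (c + of_nat n)) has_field_derivative - 1 / (w + of_nat n)\<^sup>2) (at w)"
        using nz[OF w, of n] by (auto intro!: derivative_eq_intros simp: power2_eq_square)
      from DERIV_mult[OF Suc this]
      have "((\<lambda>c. 1 / pochhammer c (Suc n)) has_field_derivative
          1 / pochhammer w n * (\<Sum>k<n. - 1 / (w + of_nat k)) * (1 / (w + of_nat n))
          + - 1 / (w + of_nat n)\<^sup>2 * (1 / pochhammer w n)) (at w)"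
        by (simp add: pochhammer_Suc)
      also have "1 / pochhammer w n * (\<Sum>k<n. - 1 / (w + of_nat k)) * (1 / (w + of_nat n))
          + - 1 / (w + of_nat n)\<^sup>2 * (1 / pochhammer w n)
          = 1 / pochhammer w (Suc n) * (\<Sum>k<Suc n. - 1 / (w + of_nat k))"
        unfolding pochhammer_Suc sum.lessThan_Suc by (rule split) (use nz[OF w, of n] p in auto)
      finally show ?case .
    qed simp
    thus ?thesis by (simp add: L_def)
  qed
  have "(deriv ^^ r) (\<lambda>c. 1 / pochhammer c n) c =
      1 / pochhammer c n * bell_complete r (\<lambda>j. L (j - 1) c)"
    using c by (intro higher_deriv_log_derivative[OF S _ df dL]) auto
  also have "bell_complete r (\<lambda>j. L (j - 1) c) =
      bell_complete r (\<lambda>j. (-1) ^ j * (fact (j - 1) * shifted_harmonic j n c))"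
    by (intro bell_complete_cong)
       (auto simp: L_def shifted_harmonic_def sum_distrib_left simp flip: power_Suc)
  also have "\<dots> = (-1) ^ r * harmonic_bell r n c"
    unfolding bell_complete_scale harmonic_bell_def ..
  finally show ?thesis by simp
qed

section \<open>Coefficients of the Gauss series\<close>

definition gauss_coeff :: "complex \<Rightarrow> complex \<Rightarrow> complex \<Rightarrow> nat \<Rightarrow> complex" where
  "gauss_coeff a b c n = pochhammer a n * pochhammer b n / (pochhammer c n * fact n)"

lemma gauss_coeff_0 [simp]: "gauss_coeff a b c 0 = 1"
  by (simp add: gauss_coeff_def)

lemma add_of_nat_neq_0:
  fixes c :: complex
  assumes "c \<notin> \<int>\<^sub>\<le>\<^sub>0"
  shows "c + of_nat n \<noteq> 0" "of_nat n + c \<noteq> 0"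
  using assms by (metis add_eq_0_iff2 minus_of_nat_in_nonpos_Ints add.commute)+

lemma Re_pos_not_nonpos_Ints:
  fixes z :: complex
  shows "Re z > 0 \<Longrightarrow> z \<notin> \<int>\<^sub>\<le>\<^sub>0"
  by (auto elim!: nonpos_Ints_cases)

lemma pochhammer_neq_0:
  fixes c :: complex
  assumes "c \<notin> \<int>\<^sub>\<le>\<^sub>0"
  shows "pochhammer c n \<noteq> 0"
  using add_of_nat_neq_0[OF assms] by (auto simp: pochhammer_prod)

lemma gauss_coeff_Suc:
  assumes "c \<notin> \<int>\<^sub>\<le>\<^sub>0"
  shows "gauss_coeff a b c (Suc n) * ((of_nat n + 1) * (of_nat n + c)) =
           gauss_coeff a b c n * ((of_nat n + a) * (of_nat n + b))"
proof -
  have "of_nat n + c \<noteq> 0" "of_nat n + 1 \<noteq> (0::complex)" "pochhammer c n \<noteq> 0"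
    using add_of_nat_neq_0[OF assms, of n] pochhammer_neq_0[OF assms]
    by (auto simp add: add.commute simp flip: of_nat_Suc)
  thus ?thesis
    by (simp add: gauss_coeff_def pochhammer_Suc add.commute[of _ "of_nat n"])
qed

lemma norm_exp_mult_ln:
  assumes "n > 0"
  shows "norm (exp (a * of_real (ln (real n)))) = real n powr Re a"
  using assms by (simp add: powr_def)

text \<open>
  Euler's limit \<open>(a)\<^sub>n\<^sub>+\<^sub>1 / (n! n\<^sup>a) \<longlonglongrightarrow> 1 / \<Gamma>(a)\<close> bounds \<open>(a)\<^sub>n\<^sub>+\<^sub>1\<close> from above, and its reciprocal
  bounds it from below, as in the next lemma, when \<open>a\<close> is no pole of \<open>\<Gamma>\<close>.
\<close>
lemma pochhammer_upper_bound:
  fixes a :: complex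
  obtains K where "\<And>n. n > 0 \<Longrightarrow> norm (pochhammer a (Suc n)) \<le> K * (fact n * real n powr Re a)"
    and "K \<ge> 0"
proof -
  have "Bseq (rGamma_series a)"
    using rGamma_series_LIMSEQ[of a] by (intro convergent_imp_Bseq) (auto simp: convergent_def)
  then obtain K where K: "K > 0" "\<And>n. norm (rGamma_series a n) \<le> K"
    by (auto simp: Bseq_def)
  show ?thesis
  proof (rule that[of K])
    fix n :: nat assume n: "n > 0"
    have "norm (pochhammer a (Suc n)) / (fact n * real n powr Re a) \<le> K"
      using K(2)[of n] norm_exp_mult_ln[OF n, of a]
      by (simp add: rGamma_series_def norm_divide norm_mult)
    thus "norm (pochhammer a (Suc n)) \<le> K * (fact n * real n powr Re a)"
      using n by (subst (asm) pos_divide_le_eq) auto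
  qed (use K in auto)
qed

lemma pochhammer_lower_bound:
  fixes c :: complex
  assumes c: "c \<notin> \<int>\<^sub>\<le>\<^sub>0"
  obtains K where "\<And>n. n > 0 \<Longrightarrow> fact n * real n powr Re c \<le> K * norm (pochhammer c (Suc n))"
    and "K \<ge> 0"
proof -
  have "Bseq (Gamma_series c)"
    using Gamma_series_LIMSEQ[of c] by (intro convergent_imp_Bseq) (auto simp: convergent_def)
  then obtain K where K: "K > 0" "\<And>n. norm (Gamma_series c n) \<le> K"
    by (auto simp: Bseq_def)
  show ?thesis
  proof (rule that[of K])
    fix n :: nat assume n: "n > 0"
    have "fact n * real n powr Re c / norm (pochhammer c (Suc n)) \<le> K"
      using K(2)[of n] norm_exp_mult_ln[OF n, of c]
      by (simp add: Gamma_series_def norm_divide norm_mult)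
    thus "fact n * real n powr Re c \<le> K * norm (pochhammer c (Suc n))"
      using pochhammer_neq_0[OF c, of "Suc n"] by (subst (asm) pos_divide_le_eq) auto
  qed (use K in auto)
qed

text \<open>
  The coefficients are at most of order \<open>n\<^sup>a\<^sup>+\<^sup>b\<^sup>-\<^sup>c\<^sup>-\<^sup>1\<close>. All convergence statements rest on this.
\<close>
lemma gauss_coeff_bound:
  assumes c: "c \<notin> \<int>\<^sub>\<le>\<^sub>0"
  obtains K where "K \<ge> 0"
    "\<And>n. n > 0 \<Longrightarrow> real (Suc n) * norm (gauss_coeff a b c (Suc n)) \<le> K * real n powr Re (a + b - c)"
proof -
  obtain A where A: "\<And>n. n > 0 \<Longrightarrow> norm (pochhammer a (Suc n)) \<le> A * (fact n * real n powr Re a)" "A \<ge> 0"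
    using pochhammer_upper_bound[of a] by blast
  obtain B where B: "\<And>n. n > 0 \<Longrightarrow> norm (pochhammer b (Suc n)) \<le> B * (fact n * real n powr Re b)" "B \<ge> 0"
    using pochhammer_upper_bound[of b] by blast
  obtain C where C: "\<And>n. n > 0 \<Longrightarrow> fact n * real n powr Re c \<le> C * norm (pochhammer c (Suc n))" "C \<ge> 0"
    using pochhammer_lower_bound[OF c] by blast
  show ?thesis
  proof (rule that[of "A * B * C"])
    fix n :: nat assume n: "n > 0"
    have "norm (pochhammer a (Suc n)) * norm (pochhammer b (Suc n)) * (fact n * real n powr Re c)
        \<le> (A * (fact n * real n powr Re a)) * (B * (fact n * real n powr Re b))
           * (C * norm (pochhammer c (Suc n)))"
      by (intro mult_mono[OF mult_mono[OF A(1)[OF n] B(1)[OF n]] C(1)[OF n]])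
         (auto intro!: mult_nonneg_nonneg A(2) B(2))
    hence "norm (pochhammer a (Suc n)) * norm (pochhammer b (Suc n)) / norm (pochhammer c (Suc n)) / fact n
        \<le> A * B * C * (real n powr Re a * real n powr Re b / real n powr Re c)"
      using n pochhammer_neq_0[OF c, of "Suc n"] by (simp add: field_simps)
    also have "real n powr Re a * real n powr Re b / real n powr Re c = real n powr Re (a + b - c)"
      using n by (simp add: powr_add powr_diff)
    finally show "real (Suc n) * norm (gauss_coeff a b c (Suc n)) \<le> A * B * C * real n powr Re (a + b - c)"
      by (simp add: gauss_coeff_def norm_divide norm_mult divide_simps del: of_nat_Suc)
  qed (use A B C in auto)
qed

lemma gauss_coeff_bound':
  assumes c: "c \<notin> \<int>\<^sub>\<le>\<^sub>0"
  obtains K where "\<And>n. n > 0 \<Longrightarrow>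
      norm (gauss_coeff a b c (Suc n)) \<le> K * real n powr (Re (a + b - c) - 1)"
proof -
  obtain K where K: "K \<ge> 0" "\<And>n. n > 0 \<Longrightarrow>
      real (Suc n) * norm (gauss_coeff a b c (Suc n)) \<le> K * real n powr Re (a + b - c)"
    using gauss_coeff_bound[OF c] by blast
  show ?thesis
  proof (rule that[of K])
    fix n :: nat assume n: "n > 0"
    have "norm (gauss_coeff a b c (Suc n)) \<le> real (Suc n) * norm (gauss_coeff a b c (Suc n)) / real n"
      using n by (auto simp: field_simps)
    also have "\<dots> \<le> K * real n powr Re (a + b - c) / real n"
      using K(2)[OF n] by (intro divide_right_mono) auto
    also have "\<dots> = K * real n powr (Re (a + b - c) - 1)"
      using n by (simp add: powr_diff)
    finally show "norm (gauss_coeff a b c (Suc n)) \<le> K * real n powr (Re (a + b - c) - 1)" .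
  qed
qed

lemma summable_gauss_coeff_over:
  fixes M :: complex
  assumes c: "c \<notin> \<int>\<^sub>\<le>\<^sub>0" and "Re (c - a - b) > -1" and M: "Re M > 0"
  shows "summable (\<lambda>n. norm (gauss_coeff a b c n) / norm (of_nat n + M))"
proof -
  obtain K where K: "\<And>n. n > 0 \<Longrightarrow>
      norm (gauss_coeff a b c (Suc n)) \<le> K * real n powr (Re (a + b - c) - 1)"
    using gauss_coeff_bound'[OF c] by blast
  have "summable (\<lambda>n. K * real n powr (Re (a + b - c) - 2))"
    using assms by (intro summable_mult) (simp add: summable_real_powr_iff)
  hence "summable (\<lambda>n. norm (gauss_coeff a b c (Suc n)) / norm (of_nat (Suc n) + M))"
  proof (rule summable_comparison_test_ev[rotated])
    show "eventually (\<lambda>n. norm (norm (gauss_coeff a b c (Suc n)) / norm (of_nat (Suc n) + M))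
            \<le> K * real n powr (Re (a + b - c) - 2)) sequentially"
      using eventually_gt_at_top[of 0]
    proof eventually_elim
      case (elim n)
      have "real n \<le> Re (of_nat (Suc n) + M)" using M by simp
      hence nM: "real n \<le> norm (of_nat (Suc n) + M)"
        using complex_Re_le_cmod order_trans by blast
      have "norm (gauss_coeff a b c (Suc n)) / norm (of_nat (Suc n) + M)
          \<le> norm (gauss_coeff a b c (Suc n)) / real n"
        using nM elim by (intro divide_left_mono) (auto intro!: mult_pos_pos)
      also have "\<dots> \<le> K * real n powr (Re (a + b - c) - 1) / real n"
        using K[OF elim] by (intro divide_right_mono) auto
      also have "\<dots> = K * real n powr (Re (a + b - c) - 2)"
        using elim by (simp add: powr_diff power2_eq_square)
      finally show ?case by simp
    qed
  qed
  thus ?thesis by (subst (asm) summable_Suc_iff)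
qed

lemma summable_gauss_coeff:
  assumes c: "c \<notin> \<int>\<^sub>\<le>\<^sub>0" and "Re (c - a - b) > 0"
  shows "summable (\<lambda>n. norm (gauss_coeff a b c n))"
proof -
  obtain K where K: "\<And>n. n > 0 \<Longrightarrow>
      norm (gauss_coeff a b c (Suc n)) \<le> K * real n powr (Re (a + b - c) - 1)"
    using gauss_coeff_bound'[OF c] by blast
  have "summable (\<lambda>n. K * real n powr (Re (a + b - c) - 1))"
    using assms by (intro summable_mult) (simp add: summable_real_powr_iff)
  hence "summable (\<lambda>n. norm (gauss_coeff a b c (Suc n)))"
    by (rule summable_comparison_test_ev[rotated])
       (use K in \<open>auto intro!: eventually_mono[OF eventually_gt_at_top[of 0]]\<close>)
  thus ?thesis by (subst (asm) summable_Suc_iff)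
qed

lemma of_nat_mult_gauss_coeff_tendsto_0:
  assumes c: "c \<notin> \<int>\<^sub>\<le>\<^sub>0" and "Re (c - a - b) > 0"
  shows "(\<lambda>n. of_nat n * gauss_coeff a b c n) \<longlonglongrightarrow> 0"
proof -
  obtain K where K: "K \<ge> 0" "\<And>n. n > 0 \<Longrightarrow>
      real (Suc n) * norm (gauss_coeff a b c (Suc n)) \<le> K * real n powr Re (a + b - c)"
    using gauss_coeff_bound[OF c] by blast
  have "(\<lambda>n. real n powr Re (a + b - c)) \<longlonglongrightarrow> 0"
    using assms by (intro tendsto_neg_powr filterlim_real_sequentially) auto
  hence "(\<lambda>n. K * real n powr Re (a + b - c)) \<longlonglongrightarrow> 0"
    by (rule tendsto_mult_right_zero)
  moreover have "eventually (\<lambda>n. norm (of_nat (Suc n) * gauss_coeff a b c (Suc n))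
      \<le> K * real n powr Re (a + b - c)) sequentially"
    using eventually_gt_at_top[of 0]
    by eventually_elim (use K(2) in \<open>simp add: norm_mult del: of_nat_Suc\<close>)
  ultimately have "(\<lambda>n. of_nat (Suc n) * gauss_coeff a b c (Suc n)) \<longlonglongrightarrow> 0"
    by (rule Lim_null_comparison[rotated])
  thus ?thesis by (rule LIMSEQ_imp_Suc)
qed

lemma gauss_coeff_tendsto_0:
  assumes c: "c \<notin> \<int>\<^sub>\<le>\<^sub>0" and "Re (c - a - b) > -1"
  shows "gauss_coeff a b c \<longlonglongrightarrow> 0"
proof -
  obtain K where K: "\<And>n. n > 0 \<Longrightarrow>
      norm (gauss_coeff a b c (Suc n)) \<le> K * real n powr (Re (a + b - c) - 1)"
    using gauss_coeff_bound'[OF c] by blast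
  have "(\<lambda>n. real n powr (Re (a + b - c) - 1)) \<longlonglongrightarrow> 0"
    using assms by (intro tendsto_neg_powr filterlim_real_sequentially) auto
  hence "(\<lambda>n. K * real n powr (Re (a + b - c) - 1)) \<longlonglongrightarrow> 0"
    by (rule tendsto_mult_right_zero)
  moreover have "eventually (\<lambda>n. norm (gauss_coeff a b c (Suc n))
      \<le> K * real n powr (Re (a + b - c) - 1)) sequentially"
    using eventually_gt_at_top[of 0]
    by eventually_elim (use K in simp)
  ultimately have "(\<lambda>n. gauss_coeff a b c (Suc n)) \<longlonglongrightarrow> 0"
    by (rule Lim_null_comparison[rotated])
  thus ?thesis by (rule LIMSEQ_imp_Suc)
qed

text \<open>
  Moving \<open>c\<close> to the right increases the modulus of every factor; this makes the coefficients decrease and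
  provides a dominating series for the limit \<open>c \<rightarrow> \<infinity>\<close>.
\<close>
lemma norm_pochhammer_mono:
  fixes c :: complex
  assumes "0 \<le> x" "x \<le> Re c"
  shows "norm (pochhammer (of_real x :: complex) n) \<le> norm (pochhammer c n)"
proof -
  have "norm (of_real x + of_nat i :: complex) \<le> norm (c + of_nat i)" for i
  proof -
    have "norm (of_real x + of_nat i :: complex) = x + real i"
      using assms by (metis norm_of_real of_real_add of_real_of_nat_eq abs_of_nonneg add_nonneg_nonneg of_nat_0_le_iff)
    also have "\<dots> \<le> Re (c + of_nat i)" using assms by simp
    also have "\<dots> \<le> norm (c + of_nat i)" by (rule complex_Re_le_cmod)
    finally show ?thesis .
  qed
  thus ?thesis
    unfolding pochhammer_prod prod_norm[symmetric] by (intro prod_mono conjI norm_ge_zero)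
qed

text \<open>
  To dominate \<open>1 / (w)\<^sub>n\<close> uniformly for \<open>w\<close> near \<open>c\<close>, it is compared with a single real parameter
  \<open>x\<close> slightly to the left of \<open>c\<close>. The factor \<open>\<bar>x + k\<bar>\<close> is at most \<open>\<bar>w + k\<bar>\<close> as soon as
  \<open>x + k \<ge> 0\<close>; for the finitely many other \<open>k\<close>, the quotient is bounded because \<open>w\<close> keeps a
  positive distance from the poles.
\<close>
lemma pochhammer_locally_dominated:
  fixes c :: complex
  assumes c: "c \<notin> \<int>\<^sub>\<le>\<^sub>0" and x: "x < Re c"
  obtains \<delta> B where "\<delta> > 0" "ball c \<delta> \<subseteq> - \<int>\<^sub>\<le>\<^sub>0"
    "\<And>w n. w \<in> ball c \<delta> \<Longrightarrow> norm (pochhammer (of_real x :: complex) n) \<le> B * norm (pochhammer w n)"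
proof -
  have "open (- \<int>\<^sub>\<le>\<^sub>0 :: complex set)"
    by (simp add: open_Compl)
  then obtain e where e: "e > 0" "ball c e \<subseteq> - \<int>\<^sub>\<le>\<^sub>0"
    using c by (meson ComplI open_contains_ball)
  \<comment> \<open>on this ball \<open>w\<close> stays to the right of \<open>x\<close> and at distance \<open>\<delta>\<close> from the poles\<close>
  define \<delta> where "\<delta> = min (e / 2) (Re c - x)"
  define N where "N = nat \<lceil>\<bar>x\<bar>\<rceil>"
  define B where "B = 1 + (\<bar>x\<bar> + real N) / \<delta>"
  have \<delta>: "\<delta> > 0" "\<delta> \<le> e / 2" "\<delta> \<le> Re c - x"
    unfolding \<delta>_def using e(1) x by linarith+
  have B: "B \<ge> 1" using \<delta>(1) by (simp add: B_def)
  have sub: "ball c \<delta> \<subseteq> - \<int>\<^sub>\<le>\<^sub>0"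
    using e \<delta> by (intro order_trans[OF subset_ball e(2)]) auto
  have away: "\<delta> \<le> norm (w + of_nat k)" if w: "w \<in> ball c \<delta>" for w k
  proof (rule ccontr)
    assume "\<not> \<delta> \<le> norm (w + of_nat k)"
    hence "dist w (- of_nat k) < \<delta>" by (simp add: dist_norm)
    moreover have "dist c w < \<delta>" using w by simp
    ultimately have "dist c (- of_nat k) < e"
      using dist_triangle[of c "- of_nat k" w] \<delta>(2) by linarith
    hence "- of_nat k \<in> ball c e" by simp
    thus False using e(2) by auto
  qed
  have right: "x \<le> Re w" if "w \<in> ball c \<delta>" for w
  proof -
    have "\<bar>Re (c - w)\<bar> < \<delta>"
      using that abs_Re_le_cmod[of "c - w"] by (auto simp: dist_norm)
    thus ?thesis using \<delta>(3) by auto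
  qed
  have factor: "norm (of_real x + of_nat k :: complex) \<le> (if k < N then B else 1) * norm (w + of_nat k)"
    if w: "w \<in> ball c \<delta>" for w k
  proof (cases "k < N")
    case True
    have "norm (of_real x + of_nat k :: complex) \<le> \<bar>x\<bar> + real k"
      by (rule order_trans[OF norm_triangle_ineq]) simp
    also have "\<dots> \<le> (\<bar>x\<bar> + real N) / \<delta> * \<delta>" using True \<delta>(1) by simp
    also have "\<dots> \<le> B * norm (w + of_nat k)"
      using B \<delta>(1) away[OF w, of k] by (intro mult_mono) (auto simp: B_def)
    finally show ?thesis using True by simp
  next
    case False
    hence "x + real k \<ge> 0" unfolding N_def by linarith
    hence "norm (of_real x + of_nat k :: complex) = x + real k"
      by (metis norm_of_real of_real_add of_real_of_nat_eq abs_of_nonneg)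
    also have "\<dots> \<le> Re (w + of_nat k)" using right[OF w] by simp
    also have "\<dots> \<le> norm (w + of_nat k)" by (rule complex_Re_le_cmod)
    finally show ?thesis using False by simp
  qed
  show ?thesis
  proof (rule that[OF \<delta>(1) sub])
    fix w :: complex and n :: nat assume w: "w \<in> ball c \<delta>"
    have "norm (pochhammer (of_real x :: complex) n) \<le> (\<Prod>k<n. (if k < N then B else 1) * norm (w + of_nat k))"
      unfolding pochhammer_prod prod_norm[symmetric] atLeast0LessThan
      by (intro prod_mono conjI factor[OF w] norm_ge_zero)
    also have "\<dots> = (\<Prod>k<n. if k < N then B else 1) * norm (pochhammer w n)"
      by (simp add: prod.distrib pochhammer_prod atLeast0LessThan flip: prod_norm)
    also have "(\<Prod>k<n. if k < N then B else 1) \<le> B ^ N"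
    proof -
      have "(\<Prod>k<n. if k < N then B else 1) = (\<Prod>k\<in>{..<n} \<inter> {..<N}. B)"
        by (subst prod.inter_restrict) auto
      also have "\<dots> \<le> B ^ N"
        using B card_mono[of "{..<N}" "{..<n} \<inter> {..<N}"] by (simp add: power_increasing)
      finally show ?thesis .
    qed
    finally show "norm (pochhammer (of_real x :: complex) n) \<le> B ^ N * norm (pochhammer w n)"
      by (simp add: mult_right_mono)
  qed
qed

lemma norm_gauss_coeff_le:
  assumes "norm (pochhammer x n) \<le> B * norm (pochhammer c n)"
    and "x \<notin> \<int>\<^sub>\<le>\<^sub>0" "c \<notin> \<int>\<^sub>\<le>\<^sub>0"
  shows "norm (gauss_coeff a b c n) \<le> B * norm (gauss_coeff a b x n)"
proof -
  have "0 < norm (pochhammer x n)" "0 < norm (pochhammer c n)"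
    using pochhammer_neq_0 assms(2,3) by auto
  hence "1 / norm (pochhammer c n) \<le> B / norm (pochhammer x n)"
    using assms(1) by (simp add: divide_simps mult.commute)
  hence "norm (pochhammer a n) * norm (pochhammer b n) / fact n * (1 / norm (pochhammer c n))
      \<le> norm (pochhammer a n) * norm (pochhammer b n) / fact n * (B / norm (pochhammer x n))"
    by (intro mult_left_mono) auto
  thus ?thesis
    by (simp add: gauss_coeff_def norm_divide norm_mult mult_ac)
qed

section \<open>Gauss summation\<close>

lemma gauss_coeff_shift_c:
  assumes "c \<notin> \<int>\<^sub>\<le>\<^sub>0"
  shows "gauss_coeff a b c n / (of_nat n + c) = gauss_coeff a b (c + 1) n / c"
proof -
  have "pochhammer c n * (c + of_nat n) = c * pochhammer (c + 1) n"
    using pochhammer_rec[of c n] pochhammer_Suc[of c n] by simp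
  thus ?thesis
    using add_of_nat_neq_0[OF assms] pochhammer_neq_0[OF assms]
    by (simp add: gauss_coeff_def field_simps)
qed

text \<open>
  Dividing \<open>(n+a)(n+b)\<close> by \<open>n+c\<close> leaves the remainder \<open>(c-a)(c-b)\<close>, and dividing a coefficient by
  \<open>n+c\<close> raises the lower parameter. The right-hand side converges already for
  \<open>Re (c - a - b) > -1\<close>, in contrast to the sum on the left.
\<close>
lemma gauss_coeff_partial_sum:
  assumes c: "c \<notin> \<int>\<^sub>\<le>\<^sub>0"
  shows "of_nat N * gauss_coeff a b c N + (c - a - b) * (\<Sum>n<N. gauss_coeff a b c n) =
           (c - a) * (c - b) / c * (\<Sum>n<N. gauss_coeff a b (c + 1) n)"
proof (induction N)
  case (Suc N)
  have nz: "of_nat N + c \<noteq> 0" using add_of_nat_neq_0[OF c] by simp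
  have "of_nat (Suc N) * gauss_coeff a b c (Suc N) =
      gauss_coeff a b c N * ((of_nat N + a) * (of_nat N + b)) / (of_nat N + c)"
    using gauss_coeff_Suc[OF c, of a b N] nz by (simp add: field_simps)
  also have "(of_nat N + a) * (of_nat N + b) =
      (of_nat N + c) * (of_nat N - (c - a - b)) + (c - a) * (c - b)"
    by (simp add: algebra_simps)
  also have "gauss_coeff a b c N * \<dots> / (of_nat N + c) =
      gauss_coeff a b c N * (of_nat N - (c - a - b)) + (c - a) * (c - b) * (gauss_coeff a b c N / (of_nat N + c))"
    using nz by (simp add: field_simps)
  also have "gauss_coeff a b c N / (of_nat N + c) = gauss_coeff a b (c + 1) N / c"
    by (rule gauss_coeff_shift_c[OF c])
  finally have step: "of_nat (Suc N) * gauss_coeff a b c (Suc N) =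
      gauss_coeff a b c N * (of_nat N - (c - a - b)) + (c - a) * (c - b) / c * gauss_coeff a b (c + 1) N"
    by simp
  show ?case
    unfolding step sum.lessThan_Suc distrib_left Suc[symmetric] by (simp add: algebra_simps)
qed simp

lemma plus_of_nat_nonpos_Ints:
  fixes c :: complex
  assumes "c \<notin> \<int>\<^sub>\<le>\<^sub>0"
  shows "c + of_nat n \<notin> \<int>\<^sub>\<le>\<^sub>0"
proof
  assume "c + of_nat n \<in> \<int>\<^sub>\<le>\<^sub>0"
  then obtain k where "c + of_nat n = - of_nat k" by (elim nonpos_Ints_cases')
  hence "c = - of_nat (k + n)" by (simp add: algebra_simps eq_neg_iff_add_eq_0)
  thus False using assms by (metis minus_of_nat_in_nonpos_Ints)
qed

lemma gauss_sum_rec: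
  assumes c: "c \<notin> \<int>\<^sub>\<le>\<^sub>0" and re: "Re (c - a - b) > 0"
  shows "(c - a - b) * (\<Sum>n. gauss_coeff a b c n) =
           (c - a) * (c - b) / c * (\<Sum>n. gauss_coeff a b (c + 1) n)"
proof -
  have c1: "c + 1 \<notin> \<int>\<^sub>\<le>\<^sub>0" using plus_of_nat_nonpos_Ints[OF c, of 1] by simp
  have "(\<lambda>N. of_nat N * gauss_coeff a b c N + (c - a - b) * (\<Sum>n<N. gauss_coeff a b c n))
      \<longlonglongrightarrow> 0 + (c - a - b) * (\<Sum>n. gauss_coeff a b c n)"
    by (intro tendsto_intros of_nat_mult_gauss_coeff_tendsto_0 summable_LIMSEQ
          summable_norm_cancel[OF summable_gauss_coeff] c re)
  moreover have "(\<lambda>N. (c - a) * (c - b) / c * (\<Sum>n<N. gauss_coeff a b (c + 1) n))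
      \<longlonglongrightarrow> (c - a) * (c - b) / c * (\<Sum>n. gauss_coeff a b (c + 1) n)"
    using re by (intro tendsto_intros summable_LIMSEQ
          summable_norm_cancel[OF summable_gauss_coeff] c1) auto
  ultimately show ?thesis
    unfolding gauss_coeff_partial_sum[OF c] using LIMSEQ_unique by fastforce
qed

lemma gauss_sum_rec_iterated:
  assumes c: "c \<notin> \<int>\<^sub>\<le>\<^sub>0" and re: "Re (c - a - b) > 0"
  shows "pochhammer c N * pochhammer (c - a - b) N * (\<Sum>n. gauss_coeff a b c n) =
           pochhammer (c - a) N * pochhammer (c - b) N * (\<Sum>n. gauss_coeff a b (c + of_nat N) n)"
proof (induction N)
  case (Suc N)
  let ?d = "c + of_nat N"
  have d: "?d \<notin> \<int>\<^sub>\<le>\<^sub>0" by (rule plus_of_nat_nonpos_Ints[OF c])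
  have nz: "?d \<noteq> 0" using add_of_nat_neq_0[OF c] by simp
  have "Re (?d - a - b) > 0" using re by simp
  from gauss_sum_rec[OF d this] nz
  have rec: "?d * (?d - a - b) * (\<Sum>n. gauss_coeff a b ?d n) =
      (?d - a) * (?d - b) * (\<Sum>n. gauss_coeff a b (?d + 1) n)"
    by (simp add: field_simps)
  have "pochhammer c (Suc N) * pochhammer (c - a - b) (Suc N) * (\<Sum>n. gauss_coeff a b c n) =
      (pochhammer c N * pochhammer (c - a - b) N * (\<Sum>n. gauss_coeff a b c n)) * (?d * (?d - a - b))"
    by (simp add: pochhammer_Suc algebra_simps)
  also have "\<dots> = pochhammer (c - a) N * pochhammer (c - b) N * (?d * (?d - a - b) * (\<Sum>n. gauss_coeff a b ?d n))"
    unfolding Suc by (simp add: mult_ac)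
  also have "\<dots> = pochhammer (c - a) (Suc N) * pochhammer (c - b) (Suc N)
      * (\<Sum>n. gauss_coeff a b (c + of_nat (Suc N)) n)"
    unfolding rec by (simp add: pochhammer_Suc algebra_simps)
  finally show ?case .
qed simp

lemma inverse_pochhammer_shift_tendsto_0:
  "(\<lambda>n. 1 / pochhammer (c + of_nat n) (Suc k)) \<longlonglongrightarrow> (0 :: complex)"
proof (induction k)
  have lim: "(\<lambda>n. 1 / (w + of_nat n)) \<longlonglongrightarrow> 0" for w :: complex
    using tendsto_add_filterlim_at_infinity[OF tendsto_const tendsto_of_nat, of w]
    by (intro tendsto_divide_0[OF tendsto_const])
  case 0
  show ?case using lim[of c] by simp
  case (Suc k)
  have "(\<lambda>n. 1 / pochhammer (c + of_nat n) (Suc k) * (1 / (c + of_nat (Suc k) + of_nat n))) \<longlonglongrightarrow> 0 * 0"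
    by (intro tendsto_mult Suc lim)
  thus ?case by (simp add: pochhammer_Suc[of _ "Suc k"] add_ac)
qed

text \<open>
  Only the constant term survives, by dominated convergence.
\<close>
lemma gauss_sum_shift_tendsto_1:
  "(\<lambda>N. \<Sum>n. gauss_coeff a b (c + of_nat N) n) \<longlonglongrightarrow> 1"
proof -
  \<comment> \<open>a parameter in the range of convergence which \<open>c + N\<close> eventually passes on the right\<close>
  define x where "x = max 1 (Re (a + b) + 1)"
  have x: "complex_of_real x \<notin> \<int>\<^sub>\<le>\<^sub>0" "Re (of_real x - a - b) > 0"
    by (auto simp: x_def max_def intro!: Re_pos_not_nonpos_Ints)
  define u where "u k = (if k = 0 then 1 else 0 :: complex)" for k :: nat
  have *: "(\<lambda>N. suminf (\<lambda>k. gauss_coeff a b (c + of_nat N) k)) \<longlonglongrightarrow> suminf u"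
  proof (rule conjunct2[OF conjunct2[OF tannerys_theorem]])
    show "(\<lambda>N. gauss_coeff a b (c + of_nat N) k) \<longlonglongrightarrow> u k" for k
    proof (cases k)
      case (Suc j)
      have "(\<lambda>N. pochhammer a k * pochhammer b k / fact k * (1 / pochhammer (c + of_nat N) (Suc j)))
          \<longlonglongrightarrow> pochhammer a k * pochhammer b k / fact k * 0"
        by (intro tendsto_intros inverse_pochhammer_shift_tendsto_0)
      thus ?thesis by (simp add: u_def gauss_coeff_def Suc mult_ac)
    qed (simp add: u_def)
    show "summable (\<lambda>k. norm (gauss_coeff a b (of_real x) k))"
      by (rule summable_gauss_coeff[OF x])
    have "eventually (\<lambda>N. real N \<ge> x - Re c) sequentially"
      using filterlim_real_sequentially by (simp add: filterlim_at_top)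
    hence "eventually (\<lambda>N. \<forall>k. norm (gauss_coeff a b (c + of_nat N) k) \<le> norm (gauss_coeff a b (of_real x) k)) sequentially"
    proof eventually_elim
      case (elim N)
      show ?case
      proof
        fix k
        have "c + of_nat N \<notin> \<int>\<^sub>\<le>\<^sub>0"
          using elim by (intro Re_pos_not_nonpos_Ints) (simp add: x_def)
        moreover have "norm (pochhammer (complex_of_real x) k) \<le> norm (pochhammer (c + of_nat N) k)"
          using elim by (intro norm_pochhammer_mono) (auto simp: x_def)
        ultimately show "norm (gauss_coeff a b (c + of_nat N) k) \<le> norm (gauss_coeff a b (of_real x) k)"
          using norm_gauss_coeff_le[of "of_real x" k 1 "c + of_nat N" a b] x(1) by simp
      qed
    qed
    thus "eventually (\<lambda>(k, N). norm (gauss_coeff a b (c + of_nat N) k) \<le> norm (gauss_coeff a b (of_real x) k))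
        (at_top \<times>\<^sub>F sequentially)"
      unfolding eventually_prod_filter
      by (intro exI[of _ "\<lambda>_. True"] exI[of _ "\<lambda>N. \<forall>k. norm (gauss_coeff a b (c + of_nat N) k)
            \<le> norm (gauss_coeff a b (of_real x) k)"] conjI) auto
  qed auto
  have "u sums 1"
    unfolding u_def using sums_single[of 0 "\<lambda>_. 1 :: complex"] by simp
  with * show ?thesis by (simp add: sums_unique[symmetric])
qed

text \<open>
  The iterated recursion relates the sum to the sum at \<open>c + N\<close> by a quotient of Pochhammer
  symbols. In Euler's limits for the four Gamma functions the powers of \<open>N\<close> cancel, since
  \<open>c + (c - a - b) = (c - a) + (c - b)\<close>.
\<close>
theorem gauss_summation:
  assumes c: "c \<notin> \<int>\<^sub>\<le>\<^sub>0" and re: "Re (c - a - b) > 0"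
  shows "(\<Sum>n. gauss_coeff a b c n) =
           Gamma c * Gamma (c - a - b) * rGamma (c - a) * rGamma (c - b)"
proof -
  let ?S = "\<Sum>n. gauss_coeff a b c n"
  have d: "c - a - b \<notin> \<int>\<^sub>\<le>\<^sub>0"
    by (rule Re_pos_not_nonpos_Ints[OF re])
  have eq: "rGamma_series c n * rGamma_series (c - a - b) n * ?S =
      rGamma_series (c - a) n * rGamma_series (c - b) n * (\<Sum>k. gauss_coeff a b (c + of_nat (n + 1)) k)" for n
  proof -
    let ?e = "\<lambda>z. exp (z * of_real (ln (of_nat n))) :: complex"
    have "?e c * ?e (c - a - b) = ?e (c - a) * ?e (c - b)"
      by (simp flip: exp_add) (simp add: algebra_simps)
    moreover have "p / (f * e) * (q / (f * e')) * s = p * q * s / (f * f * (e * e'))"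
      for p q f e e' s :: complex by simp
    ultimately show ?thesis
      unfolding rGamma_series_def using gauss_sum_rec_iterated[OF c re, of "n + 1"] by simp
  qed
  have "(\<lambda>n. rGamma_series c n * rGamma_series (c - a - b) n * ?S)
      \<longlonglongrightarrow> rGamma (c - a) * rGamma (c - b) * 1"
    unfolding eq by (intro tendsto_intros LIMSEQ_ignore_initial_segment[OF gauss_sum_shift_tendsto_1])
  moreover have "(\<lambda>n. rGamma_series c n * rGamma_series (c - a - b) n * ?S)
      \<longlonglongrightarrow> rGamma c * rGamma (c - a - b) * ?S"
    by (intro tendsto_intros)
  ultimately have "rGamma c * rGamma (c - a - b) * ?S = rGamma (c - a) * rGamma (c - b)"
    using LIMSEQ_unique by fastforce
  moreover have "Gamma c * rGamma c = 1" "Gamma (c - a - b) * rGamma (c - a - b) = 1"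
    using c d by (auto simp: Gamma_def rGamma_eq_zero_iff)
  moreover have "S = g * h * p * q" if "r * s * S = p * q" "g * r = 1" "h * s = 1"
    for g h p q r s S :: complex
    using that by algebra
  ultimately show ?thesis by blast
qed

text \<open>
  For \<open>Re (c - a - b) \<le> 0\<close> the two summands on the left may diverge separately. Their sum is
  evaluated by the Gauss sum at \<open>c + 1\<close>, and the functional equation of \<open>\<Gamma>\<close> absorbs the shift.
\<close>
lemma gauss_coeff_partial_sum_tendsto:
  assumes c: "c \<notin> \<int>\<^sub>\<le>\<^sub>0" and re: "Re (c - a - b) > -1"
  shows "(\<lambda>N. of_nat N * gauss_coeff a b c N + (c - a - b) * (\<Sum>n<N. gauss_coeff a b c n))
           \<longlonglongrightarrow> E_plus a b c"
proof -
  have c1: "c + 1 \<notin> \<int>\<^sub>\<le>\<^sub>0" using plus_of_nat_nonpos_Ints[OF c, of 1] by simp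
  have re1: "Re (c + 1 - a - b) > 0" using re by simp
  have "(\<lambda>N. (c - a) * (c - b) / c * (\<Sum>n<N. gauss_coeff a b (c + 1) n))
      \<longlonglongrightarrow> (c - a) * (c - b) / c * (\<Sum>n. gauss_coeff a b (c + 1) n)"
    by (intro tendsto_intros summable_LIMSEQ summable_norm_cancel[OF summable_gauss_coeff] c1 re1)
  also have "(c - a) * (c - b) / c * (\<Sum>n. gauss_coeff a b (c + 1) n) =
      (Gamma (c + 1) / c) * Gamma (c - a - b + 1) *
      ((c - a) * rGamma (c - a + 1)) * ((c - b) * rGamma (c - b + 1))"
  proof -
    have e: "c + 1 - a = c - a + 1" "c + 1 - b = c - b + 1" "c - a + 1 - b = c - a - b + 1"
      by (simp_all add: algebra_simps)
    show ?thesis unfolding gauss_summation[OF c1 re1] e by simp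
  qed
  also have "Gamma (c + 1) / c = Gamma c"
    using c add_of_nat_neq_0[OF c, of 0] by (simp add: Gamma_plus1)
  finally show ?thesis
    unfolding gauss_coeff_partial_sum[OF c] E_plus_def rGamma_plus1 .
qed

section \<open>Continuation of the Gauss series to the slit plane\<close>

text \<open>
  The Taylor coefficients at \<open>0\<close> of the solution of \<open>w Y' = \<alpha> Z\<close>, \<open>w Z' = \<beta> Y + \<gamma> Z\<close> with
  \<open>Y(0) = 1\<close> and \<open>Z(0) = 0\<close>, provided that \<open>\<beta>(0) = 0\<close>.
\<close>
fun singular_system_coeff ::
  "complex fps \<Rightarrow> complex fps \<Rightarrow> complex fps \<Rightarrow> nat \<Rightarrow> complex \<times> complex" where
  "singular_system_coeff \<alpha> \<beta> \<gamma> n =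
     (if n = 0 then (1, 0) else
      let v = (\<Sum>k<n. \<beta> $ (n - k) * fst (singular_system_coeff \<alpha> \<beta> \<gamma> k)
                     + \<gamma> $ (n - k) * snd (singular_system_coeff \<alpha> \<beta> \<gamma> k)) / (of_nat n - \<gamma> $ 0)
      in (((\<Sum>k<n. \<alpha> $ (n - k) * snd (singular_system_coeff \<alpha> \<beta> \<gamma> k)) + \<alpha> $ 0 * v) / of_nat n, v))"

declare singular_system_coeff.simps [simp del]

text \<open>
  The denominators \<open>n - g\<close> of the recursion are comparable to \<open>n\<close>.
\<close>
lemma of_nat_le_norm_diff:
  fixes g :: complex
  assumes "\<And>n. n > 0 \<Longrightarrow> of_nat n \<noteq> g"
  obtains D where "D \<ge> 0" "\<And>n. n > 0 \<Longrightarrow> real n \<le> D * norm (of_nat n - g)"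
proof -
  have "(\<lambda>n. inverse (1 - g / of_nat n)) \<longlonglongrightarrow> inverse (1 - 0)"
    by (intro tendsto_intros lim_const_over_n) auto
  hence "Bseq (\<lambda>n. inverse (1 - g / of_nat n))"
    by (intro convergent_imp_Bseq) (auto simp: convergent_def)
  then obtain D where D: "D > 0" "\<And>n. norm (inverse (1 - g / of_nat n)) \<le> D"
    by (auto simp: Bseq_def)
  show ?thesis
  proof (rule that[of D])
    fix n :: nat assume n: "n > 0"
    have "inverse (1 - g / of_nat n) = of_nat n / (of_nat n - g)"
      using n assms[OF n] by (simp add: field_simps)
    hence "real n / norm (of_nat n - g) \<le> D"
      using D(2)[of n] by (simp add: norm_divide)
    thus "real n \<le> D * norm (of_nat n - g)"
      using assms[OF n] by (subst (asm) pos_divide_le_eq) auto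
  qed (use D in auto)
qed

text \<open>
  The hypothesis gives \<open>S n \<le> (1 + L / n) S (n - 1)\<close> for the partial sums, so they grow at most
  polynomially and the ratio test applies to \<open>S n r\<^sup>n\<close>.
\<close>
lemma summable_of_sum_bound:
  fixes s :: "nat \<Rightarrow> real"
  assumes s: "\<And>n. s n \<ge> 0" and L: "\<And>n. n > 0 \<Longrightarrow> s n \<le> L / real n * (\<Sum>k<n. s k)" "L \<ge> 0"
    and r: "0 < r" "r < 1"
  shows "summable (\<lambda>n. s n * r ^ n)"
proof -
  define S where "S n = (\<Sum>k<Suc n. s k)" for n
  have S: "S n \<ge> 0" "s n \<le> S n" for n
    using sum_nonneg[of "{..<n}" s] s by (simp_all add: S_def)
  have "(\<lambda>n. (1 + L / real (Suc n)) * r) \<longlonglongrightarrow> (1 + 0) * r"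
    by (intro tendsto_intros LIMSEQ_Suc[OF lim_const_over_n])
  hence "eventually (\<lambda>n. (1 + L / real (Suc n)) * r < (1 + r) / 2) sequentially"
    by (rule order_tendstoD) (use r in auto)
  then obtain N where N: "\<And>n. n \<ge> N \<Longrightarrow> (1 + L / real (Suc n)) * r < (1 + r) / 2"
    unfolding eventually_sequentially by blast
  have "summable (\<lambda>n. S n * r ^ n)"
  proof (rule summable_ratio_test[of "(1 + r) / 2" N])
    fix n assume n: "n \<ge> N"
    have "S (Suc n) \<le> (1 + L / real (Suc n)) * S n"
      using L(1)[of "Suc n"] by (simp add: S_def algebra_simps)
    hence "S (Suc n) * r ^ Suc n \<le> (1 + L / real (Suc n)) * S n * r ^ Suc n"
      using r by (intro mult_right_mono) auto
    also have "\<dots> = ((1 + L / real (Suc n)) * r) * (S n * r ^ n)" by simp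
    also have "\<dots> \<le> (1 + r) / 2 * (S n * r ^ n)"
      using N[OF n] S r by (intro mult_right_mono) auto
    finally show "norm (S (Suc n) * r ^ Suc n) \<le> (1 + r) / 2 * norm (S n * r ^ n)"
      using S r by (simp add: abs_mult)
  qed (use r in auto)
  thus ?thesis
    by (rule summable_comparison_test') (use S s r in \<open>auto simp: abs_mult intro!: mult_right_mono\<close>)
qed

text \<open>
  Bounded coefficients of the system have radius of convergence at least \<open>1\<close>, and the formal
  solution inherits it: solving for the \<open>n\<close>-th coefficients divides a sum over all earlier ones
  by a quantity comparable to \<open>n\<close>. The condition on \<open>\<gamma> $ 0\<close> excludes resonances, that is, zero
  denominators.
\<close>
lemma regular_singular_system_solution:
  fixes \<alpha> \<beta> \<gamma> :: "complex fps"
  assumes bound: "\<And>n. norm (\<alpha> $ n) \<le> K" "\<And>n. norm (\<beta> $ n) \<le> K" "\<And>n. norm (\<gamma> $ n) \<le> K"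
    and \<beta>0: "\<beta> $ 0 = 0" and nonres: "\<And>n. n > 0 \<Longrightarrow> of_nat n \<noteq> \<gamma> $ 0"
  obtains Y Z :: "complex fps" where
    "fps_X * fps_deriv Y = \<alpha> * Z" "fps_X * fps_deriv Z = \<beta> * Y + \<gamma> * Z"
    "Y $ 0 = 1" "fps_conv_radius Y \<ge> 1" "fps_conv_radius Z \<ge> 1"
proof -
  define y where "y n = fst (singular_system_coeff \<alpha> \<beta> \<gamma> n)" for n
  define z where "z n = snd (singular_system_coeff \<alpha> \<beta> \<gamma> n)" for n
  have y0: "y 0 = 1" and z0: "z 0 = 0"
    by (simp_all add: y_def z_def singular_system_coeff.simps)
  have z: "(of_nat n - \<gamma> $ 0) * z n = (\<Sum>k<n. \<beta> $ (n - k) * y k + \<gamma> $ (n - k) * z k)" if "n > 0" for n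
    using that nonres[OF that]
    by (simp add: y_def z_def singular_system_coeff.simps[of _ _ _ n] Let_def)
  have y: "of_nat n * y n = (\<Sum>k<n. \<alpha> $ (n - k) * z k) + \<alpha> $ 0 * z n" if "n > 0" for n
    using that
    by (simp add: y_def z_def singular_system_coeff.simps[of _ _ _ n] Let_def)
  define s where "s n = norm (y n) + norm (z n)" for n
  obtain D where D: "D \<ge> 0" "\<And>n. n > 0 \<Longrightarrow> real n \<le> D * norm (of_nat n - \<gamma> $ 0)"
    using of_nat_le_norm_diff[OF nonres] by blast
  have K: "K \<ge> 0" using bound(1)[of 0] norm_ge_zero order_trans by blast
  have zle: "real n * norm (z n) \<le> D * K * (\<Sum>k<n. s k)" if n: "n > 0" for n
  proof -
    have "real n * norm (z n) \<le> D * norm (of_nat n - \<gamma> $ 0) * norm (z n)"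
      using D(2)[OF n] by (intro mult_right_mono) auto
    also have "\<dots> = D * norm (\<Sum>k<n. \<beta> $ (n - k) * y k + \<gamma> $ (n - k) * z k)"
      unfolding z[OF n, symmetric] by (simp add: norm_mult)
    also have "\<dots> \<le> D * (\<Sum>k<n. K * s k)"
    proof (intro mult_left_mono sum_norm_le D(1))
      fix k
      have "norm (\<beta> $ (n - k) * y k + \<gamma> $ (n - k) * z k) \<le> norm (\<beta> $ (n - k)) * norm (y k) + norm (\<gamma> $ (n - k)) * norm (z k)"
        by (rule order_trans[OF norm_triangle_ineq]) (simp add: norm_mult)
      also have "\<dots> \<le> K * norm (y k) + K * norm (z k)"
        by (intro add_mono mult_right_mono bound) auto
      finally show "norm (\<beta> $ (n - k) * y k + \<gamma> $ (n - k) * z k) \<le> K * s k"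
        by (simp add: s_def distrib_left)
    qed
    finally show ?thesis by (simp add: sum_distrib_left mult_ac)
  qed
  have yle: "real n * norm (y n) \<le> (K + K * (D * K)) * (\<Sum>k<n. s k)" if n: "n > 0" for n
  proof -
    have "norm (\<Sum>k<n. \<alpha> $ (n - k) * z k) \<le> (\<Sum>k<n. K * s k)"
    proof (intro sum_norm_le)
      fix k
      show "norm (\<alpha> $ (n - k) * z k) \<le> K * s k"
        unfolding norm_mult using K by (intro mult_mono bound) (auto simp: s_def)
    qed
    moreover have "norm (\<alpha> $ 0 * z n) \<le> K * (D * K * (\<Sum>k<n. s k))"
    proof -
      have "norm (z n) \<le> real n * norm (z n)"
        using n by (simp add: mult_le_cancel_right1)
      hence "norm (z n) \<le> D * K * (\<Sum>k<n. s k)" using zle[OF n] by simp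
      thus ?thesis unfolding norm_mult using K by (intro mult_mono bound) auto
    qed
    moreover have "real n * norm (y n) = norm ((\<Sum>k<n. \<alpha> $ (n - k) * z k) + \<alpha> $ 0 * z n)"
      unfolding y[OF n, symmetric] by (simp add: norm_mult)
    ultimately show ?thesis
      using norm_triangle_ineq[of "\<Sum>k<n. \<alpha> $ (n - k) * z k" "\<alpha> $ 0 * z n"]
      by (simp add: sum_distrib_left[symmetric] algebra_simps)
  qed
  define L where "L = K + K * (D * K) + D * K"
  have sle: "s n \<le> L / real n * (\<Sum>k<n. s k)" if n: "n > 0" for n
  proof -
    have "s n * real n \<le> L * (\<Sum>k<n. s k)"
      using add_mono[OF yle[OF n] zle[OF n]] by (simp add: s_def L_def algebra_simps)
    thus ?thesis using n by (simp add: field_simps)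
  qed
  have sum: "summable (\<lambda>n. s n * r ^ n)" if "0 < r" "r < 1" for r :: real
    by (rule summable_of_sum_bound[where L = L])
       (use sle that K D(1) in \<open>auto simp: s_def L_def\<close>)
  have rad: "fps_conv_radius (Abs_fps f) \<ge> 1" if f: "\<And>n. norm (f n) \<le> s n" for f
    unfolding fps_conv_radius_def
  proof (rule conv_radius_geI_ex')
    fix r :: real assume r: "0 < r" "ereal r < 1"
    show "summable (\<lambda>n. Abs_fps f $ n * of_real r ^ n)"
      by (rule summable_comparison_test'[OF sum[of r]])
         (use r f in \<open>auto simp: norm_mult norm_power intro!: mult_right_mono\<close>)
  qed
  show ?thesis
  proof (rule that[of "Abs_fps y" "Abs_fps z"])
    show "fps_X * fps_deriv (Abs_fps y) = \<alpha> * Abs_fps z"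
    proof (rule fps_ext)
      fix n
      have "(\<alpha> * Abs_fps z) $ n = (Abs_fps z * \<alpha>) $ n" by (simp add: mult.commute)
      also have "\<dots> = (\<Sum>k<n. z k * \<alpha> $ (n - k)) + z n * \<alpha> $ 0"
        by (simp add: fps_mult_nth atLeast0AtMost flip: lessThan_Suc_atMost)
      finally show "(fps_X * fps_deriv (Abs_fps y)) $ n = (\<alpha> * Abs_fps z) $ n"
        using y[of n] z0 by (cases n) (simp_all add: mult.commute)
    qed
    show "fps_X * fps_deriv (Abs_fps z) = \<beta> * Abs_fps y + \<gamma> * Abs_fps z"
    proof (rule fps_ext)
      fix n
      have "(\<beta> * Abs_fps y + \<gamma> * Abs_fps z) $ n = (Abs_fps y * \<beta>) $ n + (Abs_fps z * \<gamma>) $ n"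
        by (simp add: mult.commute)
      also have "\<dots> = (\<Sum>k<n. \<beta> $ (n - k) * y k + \<gamma> $ (n - k) * z k) + z n * \<gamma> $ 0"
        by (simp add: fps_mult_nth atLeast0AtMost sum.distrib \<beta>0 flip: lessThan_Suc_atMost)
           (simp add: mult.commute)
      finally have *: "(\<beta> * Abs_fps y + \<gamma> * Abs_fps z) $ n
          = (\<Sum>k<n. \<beta> $ (n - k) * y k + \<gamma> $ (n - k) * z k) + z n * \<gamma> $ 0" .
      show "(fps_X * fps_deriv (Abs_fps z)) $ n = (\<beta> * Abs_fps y + \<gamma> * Abs_fps z) $ n"
        unfolding * using z[of n] z0 by (cases n) (simp_all add: algebra_simps)
    qed
    show "fps_conv_radius (Abs_fps y) \<ge> 1" "fps_conv_radius (Abs_fps z) \<ge> 1"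
      by (intro rad; simp add: s_def)+
  qed (simp add: y0)
qed

lemma fps_conv_radius_ge_1_intros:
  fixes F G :: "complex fps"
  shows "fps_conv_radius F \<ge> 1 \<Longrightarrow> fps_conv_radius G \<ge> 1 \<Longrightarrow> fps_conv_radius (F + G) \<ge> 1"
    and "fps_conv_radius F \<ge> 1 \<Longrightarrow> fps_conv_radius G \<ge> 1 \<Longrightarrow> fps_conv_radius (F - G) \<ge> 1"
    and "fps_conv_radius F \<ge> 1 \<Longrightarrow> fps_conv_radius G \<ge> 1 \<Longrightarrow> fps_conv_radius (F * G) \<ge> 1"
  using fps_conv_radius_add[of F G] fps_conv_radius_diff[of F G] fps_conv_radius_mult[of F G]
  by (metis min.boundedI order_trans)+

text \<open>
  This is the hypergeometric equation for \<open>f = Y\<close> and \<open>z f' = Z\<close> after the substitution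
  \<open>z = 4 w / (1 + w)\<^sup>2\<close>, cleared of denominators. Divided by \<open>1 + w\<close> and \<open>1 - w\<^sup>2\<close>, it is a system
  with a regular singularity at \<open>0\<close> whose coefficient functions are combinations of
  \<open>(1-w)/(1+w)\<close>, \<open>w/(1-w\<^sup>2)\<close> and \<open>(1+w)/(1-w)\<close>, so their Taylor coefficients are bounded.
\<close>
lemma hypergeometric_system_on_disc:
  fixes a b c :: complex
  assumes c: "c \<notin> \<int>\<^sub>\<le>\<^sub>0"
  obtains Y Y' Z Z' :: "complex \<Rightarrow> complex" where
    "\<And>w. norm w < 1 \<Longrightarrow> (Y has_field_derivative Y' w) (at w)"
    "\<And>w. norm w < 1 \<Longrightarrow> (Z has_field_derivative Z' w) (at w)"
    "\<And>w. norm w < 1 \<Longrightarrow> w * (1 + w) * Y' w = (1 - w) * Z w"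
    "\<And>w. norm w < 1 \<Longrightarrow> w * (1 - w\<^sup>2) * Z' w =
       4 * a * b * w * Y w + (4 * (a + b) * w - (c - 1) * (1 + w)\<^sup>2) * Z w"
    "Y 0 = 1"
proof -
  \<comment> \<open>the expansions of \<open>(1-w)/(1+w)\<close>, \<open>w/(1-w\<^sup>2)\<close> and \<open>(1+w)/(1-w)\<close>\<close>
  define \<alpha> where "\<alpha> = Abs_fps (\<lambda>n. if n = 0 then 1 else 2 * (-1) ^ n :: complex)"
  define odds where "odds = Abs_fps (\<lambda>n. if odd n then 1 else 0 :: complex)"
  define \<kappa> where "\<kappa> = Abs_fps (\<lambda>n. if n = 0 then 1 else 2 :: complex)"
  define \<beta> where "\<beta> = fps_const (4 * a * b) * odds"
  define \<gamma> where "\<gamma> = fps_const (4 * (a + b)) * odds - fps_const (c - 1) * \<kappa>"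
  have \<alpha>: "(1 + fps_X) * \<alpha> = 1 - fps_X"
  proof (rule fps_ext)
    fix n show "((1 + fps_X) * \<alpha>) $ n = (1 - fps_X) $ n"
      by (cases n; cases "n - 1") (auto simp: \<alpha>_def distrib_right)
  qed
  have odds: "(1 - fps_X\<^sup>2) * odds = fps_X"
  proof (rule fps_ext)
    fix n show "((1 - fps_X\<^sup>2) * odds) $ n = fps_X $ n"
      by (cases "n = 0 \<or> n = 1") (auto simp: odds_def left_diff_distrib fps_X_power_mult_nth)
  qed
  have \<kappa>: "(1 - fps_X) * \<kappa> = 1 + fps_X"
  proof (rule fps_ext)
    fix n show "((1 - fps_X) * \<kappa>) $ n = (1 + fps_X) $ n"
      by (cases n; cases "n - 1") (auto simp: \<kappa>_def left_diff_distrib)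
  qed
  define K where "K = 2 + norm (4 * a * b) + norm (4 * (a + b)) + 2 * norm (c - 1)"
  have K: "norm (\<alpha> $ n) \<le> K" "norm (\<beta> $ n) \<le> K" "norm (\<gamma> $ n) \<le> K" for n
  proof -
    show "norm (\<alpha> $ n) \<le> K"
      by (simp add: \<alpha>_def K_def norm_mult norm_power)
    show "norm (\<beta> $ n) \<le> K"
      by (simp add: \<beta>_def odds_def K_def)
    have "norm (\<gamma> $ n) \<le> norm (4 * (a + b) * odds $ n) + norm ((c - 1) * \<kappa> $ n)"
      by (simp add: \<gamma>_def norm_triangle_ineq4)
    also have "\<dots> \<le> norm (4 * (a + b)) + 2 * norm (c - 1)"
      by (intro add_mono) (auto simp: odds_def \<kappa>_def norm_mult)
    also have "\<dots> \<le> K"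
      by (simp add: K_def)
    finally show "norm (\<gamma> $ n) \<le> K" .
  qed
  have \<beta>0: "\<beta> $ 0 = 0" by (simp add: \<beta>_def odds_def)
  have \<gamma>0: "of_nat n \<noteq> \<gamma> $ 0" if n: "n > 0" for n
  proof -
    obtain m where m: "n = Suc m" using n by (cases n) auto
    have "\<gamma> $ 0 = 1 - c" by (simp add: \<gamma>_def odds_def \<kappa>_def)
    moreover have "of_nat n - (1 - c) = c + of_nat m" by (simp add: m)
    ultimately show ?thesis using add_of_nat_neq_0(1)[OF c, of m] by (metis right_minus_eq)
  qed
  obtain F G :: "complex fps" where FG:
    "fps_X * fps_deriv F = \<alpha> * G" "fps_X * fps_deriv G = \<beta> * F + \<gamma> * G"
    "F $ 0 = 1" "fps_conv_radius F \<ge> 1" "fps_conv_radius G \<ge> 1"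
    by (rule regular_singular_system_solution[OF K \<beta>0 \<gamma>0])
  have rad: "fps_conv_radius (fps_deriv F) \<ge> 1" "fps_conv_radius (fps_deriv G) \<ge> 1"
    using FG(4,5) fps_conv_radius_deriv order_trans by blast+
  have 1: "fps_X * fps_deriv F + fps_X * (fps_X * fps_deriv F) = G - fps_X * G"
  proof -
    have "fps_X * fps_deriv F + fps_X * (fps_X * fps_deriv F) = (1 + fps_X) * \<alpha> * G"
      unfolding FG(1) by (simp add: algebra_simps)
    thus ?thesis unfolding \<alpha> by (simp add: algebra_simps)
  qed
  have 2: "fps_X * fps_deriv G - fps_X * (fps_X * (fps_X * fps_deriv G)) =
      fps_const (4 * a * b) * (fps_X * F) + (fps_const (4 * (a + b)) * (fps_X * G)
      - fps_const (c - 1) * (G + (fps_X * G + (fps_X * G + fps_X * (fps_X * G)))))"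
  proof -
    have "fps_X * fps_deriv G - fps_X * (fps_X * (fps_X * fps_deriv G)) =
        (1 - fps_X\<^sup>2) * (\<beta> * F + \<gamma> * G)"
      unfolding FG(2) by (simp add: algebra_simps power2_eq_square)
    also have "\<dots> = fps_const (4 * a * b) * ((1 - fps_X\<^sup>2) * odds) * F
        + (fps_const (4 * (a + b)) * ((1 - fps_X\<^sup>2) * odds) * G
        - fps_const (c - 1) * ((1 + fps_X) * ((1 - fps_X) * \<kappa>)) * G)"
      by (simp add: \<beta>_def \<gamma>_def algebra_simps power2_eq_square)
    finally show ?thesis unfolding odds \<kappa> by (simp add: algebra_simps)
  qed
  have ev: "eval_fps (A + B) w = eval_fps A w + eval_fps B w"
    "eval_fps (A - B) w = eval_fps A w - eval_fps B w"
    "eval_fps (A * B) w = eval_fps A w * eval_fps B w"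
    if "fps_conv_radius A \<ge> 1" "fps_conv_radius B \<ge> 1" "norm w < 1" for A B :: "complex fps" and w
  proof -
    have "ereal (norm w) < fps_conv_radius A" "ereal (norm w) < fps_conv_radius B"
      using that by (metis ereal_less(3) less_le_trans)+
    thus "eval_fps (A + B) w = eval_fps A w + eval_fps B w"
      "eval_fps (A - B) w = eval_fps A w - eval_fps B w"
      "eval_fps (A * B) w = eval_fps A w * eval_fps B w"
      by (simp_all add: eval_fps_add eval_fps_diff eval_fps_mult)
  qed
  have nw: "ereal (norm w) < fps_conv_radius F" "ereal (norm w) < fps_conv_radius G" if "norm w < 1" for w
    using that FG(4,5) by (metis ereal_less(3) less_le_trans)+
  show ?thesis
  proof (rule that[of "eval_fps F" "eval_fps (fps_deriv F)" "eval_fps G" "eval_fps (fps_deriv G)"])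
    fix w :: complex assume w: "norm w < 1"
    show "(eval_fps F has_field_derivative eval_fps (fps_deriv F) w) (at w)"
      "(eval_fps G has_field_derivative eval_fps (fps_deriv G) w) (at w)"
      using nw[OF w] by (auto intro!: has_field_derivative_eval_fps)
    have "eval_fps (fps_X * fps_deriv F + fps_X * (fps_X * fps_deriv F)) w = eval_fps (G - fps_X * G) w"
      by (simp only: 1)
    thus "w * (1 + w) * eval_fps (fps_deriv F) w = (1 - w) * eval_fps G w"
      using w rad FG(4,5) by (simp add: ev fps_conv_radius_ge_1_intros algebra_simps)
    have "eval_fps (fps_X * fps_deriv G - fps_X * (fps_X * (fps_X * fps_deriv G))) w =
      eval_fps (fps_const (4 * a * b) * (fps_X * F) + (fps_const (4 * (a + b)) * (fps_X * G)
      - fps_const (c - 1) * (G + (fps_X * G + (fps_X * G + fps_X * (fps_X * G)))))) w"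
      by (simp only: 2)
    thus "w * (1 - w\<^sup>2) * eval_fps (fps_deriv G) w =
        4 * a * b * w * eval_fps F w + (4 * (a + b) * w - (c - 1) * (1 + w)\<^sup>2) * eval_fps G w"
      using w rad FG(4,5) by (simp add: ev fps_conv_radius_ge_1_intros algebra_simps power2_eq_square)
  qed (simp add: eval_fps_at_0 FG)
qed

lemma open_slit_plane: "open slit_plane"
proof -
  have "closed (complex_of_real ` {1..})"
    by (intro closed_injective_linear_image) (auto simp: inj_on_def linear_of_real bounded_linear_of_real[THEN bounded_linear.linear])
  thus ?thesis by (simp add: slit_plane_def open_Diff)
qed

lemma ball_subset_slit_plane: "ball 0 1 \<subseteq> slit_plane"
  by (auto simp: slit_plane_def)

lemma one_minus_slit_plane:
  assumes "z \<in> slit_plane"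
  shows "1 - z \<notin> \<real>\<^sub>\<le>\<^sub>0"
proof
  assume "1 - z \<in> \<real>\<^sub>\<le>\<^sub>0"
  then obtain r where r: "r \<le> 0" "1 - z = of_real r" by (elim nonpos_Reals_cases)
  hence "z = of_real (1 - r)" by (simp add: algebra_simps)
  moreover have "1 - r \<in> {1..}" using r(1) by simp
  ultimately show False using assms unfolding slit_plane_def by blast
qed

text \<open>
  The inverse of \<open>w \<mapsto> 4 w / (1 + w)\<^sup>2\<close> is \<open>(1 - s) / (1 + s)\<close> with \<open>s = \<surd>(1 - z)\<close>. On the slit plane
  \<open>1 - z\<close> avoids the branch cut of the principal root, so \<open>s\<close> has positive real part and
  \<open>\<bar>w\<bar> < 1\<close>.
\<close>
lemma slit_plane_to_disc:
  obtains w w' :: "complex \<Rightarrow> complex" where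
    "\<And>z. z \<in> slit_plane \<Longrightarrow> (w has_field_derivative w' z) (at z)"
    "\<And>z. z \<in> slit_plane \<Longrightarrow> norm (w z) < 1"
    "\<And>z. z \<in> slit_plane \<Longrightarrow> z * (1 - w z) * w' z = w z * (1 + w z)"
    "\<And>z. z \<in> slit_plane \<Longrightarrow> z * (1 + w z)\<^sup>2 = 4 * w z"
    "\<And>z. z \<in> slit_plane \<Longrightarrow> (1 - z) * (1 + w z)\<^sup>2 = (1 - w z)\<^sup>2"
    "w 0 = 0"
proof -
  define w where "w z = (1 - csqrt (1 - z)) / (1 + csqrt (1 - z))" for z
  define w' where "w' z = 1 / (csqrt (1 - z) * (1 + csqrt (1 - z))\<^sup>2)" for z
  have s: "Re (csqrt (1 - z)) > 0" if z: "z \<in> slit_plane" for z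
  proof (rule ccontr)
    define s where "s = csqrt (1 - z)"
    assume "\<not> Re (csqrt (1 - z)) > 0"
    hence "Re s = 0" using csqrt_principal[of "1 - z"] by (auto simp: s_def simp del: csqrt.simps)
    hence "s\<^sup>2 = of_real (- (Im s)\<^sup>2)"
      by (simp add: complex_eq_iff power2_eq_square)
    hence "1 - z = of_real (- (Im s)\<^sup>2)" by (simp add: s_def)
    thus False using one_minus_slit_plane[OF z] by (simp only: nonpos_Reals_of_real_iff) simp
  qed
  have nz: "csqrt (1 - z) \<noteq> 0" "1 + csqrt (1 - z) \<noteq> 0" if "z \<in> slit_plane" for z
    using s[OF that] by (auto simp: complex_eq_iff simp del: csqrt.simps)
  have zs: "z = 1 - (csqrt (1 - z))\<^sup>2" for z
    by simp
  \<comment> \<open>in terms of \<open>s\<close> all claimed relations become rational identities\<close>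
  have w1: "1 + w z = 2 / (1 + csqrt (1 - z))" "1 - w z = 2 * csqrt (1 - z) / (1 + csqrt (1 - z))"
    if "z \<in> slit_plane" for z
    using nz[OF that] by (auto simp: w_def divide_simps)
  show ?thesis
  proof (rule that[of w w'])
    fix z assume z: "z \<in> slit_plane"
    have d: "((\<lambda>z. csqrt (1 - z)) has_field_derivative (- 1 / (2 * csqrt (1 - z)))) (at z)"
      using one_minus_slit_plane[OF z]
      by (auto intro!: derivative_eq_intros simp: field_simps)
    show "(w has_field_derivative w' z) (at z)"
      unfolding w_def w'_def
      by (rule derivative_eq_intros d refl nz[OF z])+
         (use nz[OF z] in \<open>simp add: divide_simps power2_eq_square\<close>)
    define s where "s = csqrt (1 - z)"
    have nz': "s \<noteq> 0" "1 + s \<noteq> 0" using nz[OF z] by (auto simp: s_def)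
    have "norm (1 - s) < norm (1 + s)"
      using s[OF z] by (simp add: cmod_def power2_eq_square algebra_simps flip: s_def)
    thus "norm (w z) < 1"
      using nz[OF z] by (simp add: w_def norm_divide s_def)
    have "(1 - s\<^sup>2) * (2 * s / (1 + s)) * (1 / (s * (1 + s)\<^sup>2)) = (1 - s) / (1 + s) * (2 / (1 + s))"
      using nz' by (simp add: divide_simps) (simp add: power2_eq_square algebra_simps)
    thus "z * (1 - w z) * w' z = w z * (1 + w z)"
      unfolding w1[OF z] using zs[of z] by (simp add: w'_def w_def s_def)
    have "(1 - s\<^sup>2) * (2 / (1 + s))\<^sup>2 = 4 * ((1 - s) / (1 + s))"
      using nz' by (simp add: divide_simps) (simp add: power2_eq_square algebra_simps)
    thus "z * (1 + w z)\<^sup>2 = 4 * w z"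
      unfolding w1[OF z] using zs[of z] by (simp add: w_def s_def)
    have "s\<^sup>2 * (2 / (1 + s))\<^sup>2 = (2 * s / (1 + s))\<^sup>2"
      by (simp add: power_divide power_mult_distrib)
    thus "(1 - z) * (1 + w z)\<^sup>2 = (1 - w z)\<^sup>2"
      unfolding w1[OF z] by (simp add: s_def)
  qed (simp add: w_def)
qed

text \<open>
  The solution of the system on the disc, pulled back to the slit plane, satisfies the
  hypergeometric equation there. Comparing Taylor coefficients at \<open>0\<close> gives the two-term recursion
  of the Gauss coefficients.
\<close>
lemma hypergeometric_continuation:
  fixes a b c :: complex
  assumes c: "c \<notin> \<int>\<^sub>\<le>\<^sub>0"
  obtains H where "H holomorphic_on slit_plane"
    "\<And>z. z \<in> ball 0 1 \<Longrightarrow> (\<lambda>n. gauss_coeff a b c n * z ^ n) sums H z"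
proof -
  obtain Y Y' Z Z' :: "complex \<Rightarrow> complex" where
    dY: "\<And>w. norm w < 1 \<Longrightarrow> (Y has_field_derivative Y' w) (at w)" and
    dZ: "\<And>w. norm w < 1 \<Longrightarrow> (Z has_field_derivative Z' w) (at w)" and
    Y': "\<And>w. norm w < 1 \<Longrightarrow> w * (1 + w) * Y' w = (1 - w) * Z w" and
    Z': "\<And>w. norm w < 1 \<Longrightarrow> w * (1 - w\<^sup>2) * Z' w =
       4 * a * b * w * Y w + (4 * (a + b) * w - (c - 1) * (1 + w)\<^sup>2) * Z w" and
    Y0: "Y 0 = 1"
    using hypergeometric_system_on_disc[OF c, of a b] by blast
  obtain w w' :: "complex \<Rightarrow> complex" where
    dw: "\<And>z. z \<in> slit_plane \<Longrightarrow> (w has_field_derivative w' z) (at z)" and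
    w: "\<And>z. z \<in> slit_plane \<Longrightarrow> norm (w z) < 1" and
    w': "\<And>z. z \<in> slit_plane \<Longrightarrow> z * (1 - w z) * w' z = w z * (1 + w z)" and
    zw: "\<And>z. z \<in> slit_plane \<Longrightarrow> z * (1 + w z)\<^sup>2 = 4 * w z" 
      "\<And>z. z \<in> slit_plane \<Longrightarrow> (1 - z) * (1 + w z)\<^sup>2 = (1 - w z)\<^sup>2" and
    w0: "w 0 = 0"
    using slit_plane_to_disc by blast
  define H where "H z = Y (w z)" for z
  define K where "K z = Z (w z)" for z
  have dH: "(H has_field_derivative Y' (w z) * w' z) (at z)"
    and dK: "(K has_field_derivative Z' (w z) * w' z) (at z)" if "z \<in> slit_plane" for z
    unfolding H_def K_def using that
    by (auto intro!: DERIV_chain2[OF dY dw] DERIV_chain2[OF dZ dw] w)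
  have hol: "H holomorphic_on slit_plane" "K holomorphic_on slit_plane"
    using dH dK open_slit_plane by (auto simp: holomorphic_on_open)
  have nz: "1 + w z \<noteq> 0" "1 - w z \<noteq> 0" if "z \<in> slit_plane" for z
    using w[OF that] by (auto simp: add_eq_0_iff2 dest: arg_cong[of _ _ norm])
  \<comment> \<open>the derivation \<open>z d/dz\<close> corresponds to \<open>(1+w)/(1-w)\<close> times \<open>w d/dw\<close>\<close>
  have eqH: "z * deriv H z = K z" if z: "z \<in> slit_plane" for z
  proof -
    have "(1 - w z) * (z * (Y' (w z) * w' z)) = (z * (1 - w z) * w' z) * Y' (w z)"
      by (simp add: mult_ac)
    also have "\<dots> = (1 - w z) * K z"
      unfolding w'[OF z] Y'[OF w[OF z]] K_def ..
    finally show ?thesis using nz[OF z] DERIV_imp_deriv[OF dH[OF z]] by simp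
  qed
  have eqK: "z * deriv K z - z * (z * deriv K z) = 
      a * b * (z * H z) + ((a + b) * (z * K z) - (c - 1) * K z)" if z: "z \<in> slit_plane" for z
  proof -
    let ?w = "w z"
    have "(1 + ?w)\<^sup>2 * (1 - ?w) * ((1 - z) * (z * (Z' ?w * w' z))) =
        ((1 - z) * (1 + ?w)\<^sup>2) * (z * (1 - ?w) * w' z) * Z' ?w"
      by (simp add: mult_ac)
    also have "\<dots> = (1 - ?w) * (?w * (1 - ?w\<^sup>2) * Z' ?w)"
      unfolding w'[OF z] zw(2)[OF z] by (simp add: power2_eq_square algebra_simps)
    also have "?w * (1 - ?w\<^sup>2) * Z' ?w =
        a * b * (4 * ?w) * Y ?w + ((a + b) * (4 * ?w) - (c - 1) * (1 + ?w)\<^sup>2) * Z ?w"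
      unfolding Z'[OF w[OF z]] by (simp add: algebra_simps)
    also have "\<dots> = (1 + ?w)\<^sup>2 * (a * b * (z * H z) + ((a + b) * (z * K z) - (c - 1) * K z))"
      unfolding zw(1)[OF z, symmetric] H_def K_def by (simp add: algebra_simps)
    finally have "(1 - z) * (z * (Z' ?w * w' z)) = a * b * (z * H z) + ((a + b) * (z * K z) - (c - 1) * K z)"
      using nz[OF z] by simp
    thus ?thesis using DERIV_imp_deriv[OF dK[OF z]] by (simp add: algebra_simps)
  qed
  have near: "eventually (\<lambda>z. z \<in> slit_plane) (nhds 0)"
    using ball_subset_slit_plane by (intro eventually_nhds_in_open open_slit_plane) auto
  have "0 \<in> slit_plane" using ball_subset_slit_plane by auto
  define F where "F = fps_expansion H 0"
  define G where "G = fps_expansion K 0"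
  have F: "H has_fps_expansion F" and G: "K has_fps_expansion G"
    unfolding F_def G_def using hol open_slit_plane \<open>0 \<in> slit_plane\<close> by blast+
  have FG1: "fps_X * fps_deriv F = G"
  proof (rule fps_expansion_unique_complex[OF _ G])
    have "(\<lambda>z. z * deriv H z) has_fps_expansion fps_X * fps_deriv F"
      by (intro fps_expansion_intros F)
    moreover have ev: "eventually (\<lambda>z. z * deriv H z = K z) (nhds 0)"
      using near by eventually_elim (rule eqH)
    ultimately show "K has_fps_expansion fps_X * fps_deriv F"
      using has_fps_expansion_cong[OF ev refl] by simp
  qed
  have FG2: "fps_X * fps_deriv G - fps_X * (fps_X * fps_deriv G) =
      fps_const (a * b) * (fps_X * F) + (fps_const (a + b) * (fps_X * G) - fps_const (c - 1) * G)"
  proof (rule fps_expansion_unique_complex)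
    show "(\<lambda>z. z * deriv K z - z * (z * deriv K z)) has_fps_expansion
        fps_X * fps_deriv G - fps_X * (fps_X * fps_deriv G)"
      by (intro fps_expansion_intros G)
    have "(\<lambda>z. a * b * (z * H z) + ((a + b) * (z * K z) - (c - 1) * K z)) has_fps_expansion
        fps_const (a * b) * (fps_X * F) + (fps_const (a + b) * (fps_X * G) - fps_const (c - 1) * G)"
      by (intro fps_expansion_intros F G)
    moreover have ev: "eventually (\<lambda>z. a * b * (z * H z) + ((a + b) * (z * K z) - (c - 1) * K z)
        = z * deriv K z - z * (z * deriv K z)) (nhds 0)"
      using near by eventually_elim (rule eqK[symmetric])
    ultimately show "(\<lambda>z. z * deriv K z - z * (z * deriv K z)) has_fps_expansion
        fps_const (a * b) * (fps_X * F) + (fps_const (a + b) * (fps_X * G) - fps_const (c - 1) * G)"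
      using has_fps_expansion_cong[OF ev refl] by simp
  qed
  have coeff: "F $ n = gauss_coeff a b c n" for n
  proof (induction n)
    case 0
    have "F $ 0 = H 0" using fps_nth_fps_expansion[OF F, of 0] by simp
    thus ?case by (simp add: H_def w0 Y0)
  next
    case (Suc n)
    let ?n = "of_nat n :: complex"
    have G: "G $ k = of_nat k * F $ k" for k
      unfolding FG1[symmetric] by (cases k) auto
    have "(fps_X * fps_deriv G - fps_X * (fps_X * fps_deriv G)) $ Suc n =
        (?n + 1) * G $ Suc n - ?n * G $ n"
      by (cases n) (simp_all add: add_ac)
    hence "(?n + 1) * G $ Suc n - ?n * G $ n =
        a * b * F $ n + ((a + b) * G $ n - (c - 1) * G $ Suc n)"
      unfolding FG2 by simp
    hence "F $ Suc n * ((?n + 1) * (?n + c)) = F $ n * ((?n + a) * (?n + b))"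
      unfolding G by (simp add: algebra_simps)
    also have "\<dots> = gauss_coeff a b c (Suc n) * ((?n + 1) * (?n + c))"
      unfolding Suc gauss_coeff_Suc[OF c] ..
    finally have "F $ Suc n * ((?n + 1) * (?n + c)) = gauss_coeff a b c (Suc n) * ((?n + 1) * (?n + c))" .
    moreover have "?n + 1 \<noteq> 0"
      by (metis of_nat_Suc of_nat_neq_0 add.commute)
    ultimately show ?case
      using add_of_nat_neq_0[OF c, of n] by simp
  qed
  show ?thesis
  proof (rule that[of H])
    fix z :: complex assume z: "z \<in> ball 0 1"
    have "(\<lambda>n. (deriv ^^ n) H 0 / fact n * (z - 0) ^ n) sums H z"
      using holomorphic_on_subset[OF hol(1) ball_subset_slit_plane] z
      by (rule holomorphic_power_series)
    thus "(\<lambda>n. gauss_coeff a b c n * z ^ n) sums H z"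
      by (simp add: coeff[symmetric] fps_nth_fps_expansion[OF F])
  qed (rule hol)
qed

text \<open>
  Since a continuation exists, the choice operator in the definition selects one.
\<close>
lemma hyp2F1_continuation:
  assumes "c \<notin> \<int>\<^sub>\<le>\<^sub>0"
  shows "hyp2F1 a b c holomorphic_on slit_plane"
    and "\<And>z. z \<in> ball 0 1 \<Longrightarrow> (\<lambda>n. gauss_coeff a b c n * z ^ n) sums hyp2F1 a b c z"
proof -
  obtain H where H: "H holomorphic_on slit_plane"
    "\<And>z. z \<in> ball 0 1 \<Longrightarrow> (\<lambda>n. gauss_coeff a b c n * z ^ n) sums H z"
    using hypergeometric_continuation[OF assms] by blast
  hence "H holomorphic_on slit_plane \<and>
     (\<forall>z\<in>ball 0 1. (\<lambda>n. pochhammer a n * pochhammer b n / (pochhammer c n * fact n) * z ^ n) sums H z)"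
    unfolding gauss_coeff_def by blast
  from someI[where P = "\<lambda>f. f holomorphic_on slit_plane \<and>
     (\<forall>z\<in>ball 0 1. (\<lambda>n. pochhammer a n * pochhammer b n / (pochhammer c n * fact n) * z ^ n) sums f z)", OF this]
  show "hyp2F1 a b c holomorphic_on slit_plane"
    and "\<And>z. z \<in> ball 0 1 \<Longrightarrow> (\<lambda>n. gauss_coeff a b c n * z ^ n) sums hyp2F1 a b c z"
    unfolding hyp2F1_def gauss_coeff_def by blast+
qed

section \<open>The recurrence without harmonic weights\<close>

text \<open>
  In the induction step, \<open>(M+1-a)(M+1-b)\<close> is the remainder of \<open>(n+a)(n+b)\<close> modulo \<open>n+M+1\<close>; the
  recursion of the coefficients then turns \<open>(n+a)(n+b)\<close> into \<open>(n+1)(n+c)\<close> at the index \<open>n + 1\<close>,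
  whose remainder modulo \<open>n+M+1\<close> is \<open>M(M+1-c)\<close>.
\<close>
lemma moment_telescoping:
  fixes M a b c z :: complex and N :: nat
  assumes c: "c \<notin> \<int>\<^sub>\<le>\<^sub>0" and M: "M \<notin> \<int>\<^sub>\<le>\<^sub>0"
  defines "t \<equiv> (\<lambda>n. gauss_coeff a b c n * z ^ n)"
  shows "z * (M + 1 - a) * (M + 1 - b) * (\<Sum>n<N. t n / (of_nat n + (M + 1))) =
           M * (M + 1 - c) * (\<Sum>n<Suc N. t n / (of_nat n + M))
           + (\<Sum>n<Suc N. t n * (of_nat n + c - 1 - M))
           - z * (\<Sum>n<N. t n * (of_nat n + a + b - M - 1))"
proof (induction N)
  case 0
  have "M \<noteq> 0" using M by auto
  thus ?case by (simp add: t_def algebra_simps)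
next
  case (Suc N)
  let ?n = "of_nat N :: complex"
  have nz: "?n + (M + 1) \<noteq> 0"
    using add_of_nat_neq_0[OF M, of "Suc N"] by (simp add: add_ac)
  have rec: "t (Suc N) * ((?n + 1) * (?n + c)) = z * t N * ((?n + a) * (?n + b))"
  proof -
    have "t (Suc N) * ((?n + 1) * (?n + c))
        = z * z ^ N * (gauss_coeff a b c (Suc N) * ((?n + 1) * (?n + c)))"
      by (simp add: t_def)
    also have "\<dots> = z * t N * ((?n + a) * (?n + b))"
      unfolding gauss_coeff_Suc[OF c] by (simp add: t_def)
    finally show ?thesis .
  qed
  have "z * (M + 1 - a) * (M + 1 - b) * (t N / (?n + (M + 1))) =
      z * t N * ((?n + a) * (?n + b) - (?n + (M + 1)) * (?n + a + b - M - 1)) / (?n + (M + 1))"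
  proof -
    have "(?n + a) * (?n + b) - (?n + (M + 1)) * (?n + a + b - M - 1) = (M + 1 - a) * (M + 1 - b)"
      by (simp add: algebra_simps)
    thus ?thesis by (simp add: mult_ac)
  qed
  also have "\<dots> = z * t N * ((?n + a) * (?n + b)) / (?n + (M + 1)) - z * t N * (?n + a + b - M - 1)"
    using nz by (simp add: diff_divide_distrib right_diff_distrib)
  also have "z * t N * ((?n + a) * (?n + b)) / (?n + (M + 1)) =
      t (Suc N) * (((?n + (M + 1)) * (?n + c - M) + M * (M + 1 - c)) / (?n + (M + 1)))"
  proof -
    have "(?n + (M + 1)) * (?n + c - M) + M * (M + 1 - c) = (?n + 1) * (?n + c)"
      by (simp add: algebra_simps)
    thus ?thesis unfolding rec[symmetric] by simp
  qed
  also have "\<dots> = t (Suc N) * (?n + c - M) + M * (M + 1 - c) * (t (Suc N) / (?n + (M + 1)))"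
    using nz by (simp add: add_divide_distrib distrib_left)
  finally have step: "z * (M + 1 - a) * (M + 1 - b) * (t N / (?n + (M + 1))) =
      t (Suc N) * (of_nat (Suc N) + c - 1 - M) + M * (M + 1 - c) * (t (Suc N) / (of_nat (Suc N) + M))
      - z * (t N * (?n + a + b - M - 1))"
    by (simp add: add_ac mult_ac)
  show ?case
    unfolding sum.lessThan_Suc[of _ N] sum.lessThan_Suc[of _ "Suc N"] distrib_left step Suc
    by (simp add: algebra_simps)
qed

lemma Re_add_1_pos: "Re M > 0 \<Longrightarrow> Re (M + 1) > 0" by simp

text \<open>
  The plain moment is the case \<open>z = \<epsilon>\<close>, with \<open>M\<close> in place of \<open>m + 1 + lam\<close>; the variable \<open>z\<close>
  is kept for the limit \<open>z \<rightarrow> -1\<close> from inside the disc.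
\<close>
definition moment_series :: "complex \<Rightarrow> complex \<Rightarrow> complex \<Rightarrow> complex \<Rightarrow> complex \<Rightarrow> complex" where
  "moment_series z M a b c = (\<Sum>n. gauss_coeff a b c n * z ^ n / (of_nat n + M))"

lemma norm_moment_term_le:
  assumes "norm z \<le> 1" "norm (gauss_coeff a b c n) \<le> B * norm (gauss_coeff a b d n)"
  shows "norm (gauss_coeff a b c n * z ^ n / (of_nat n + M)) \<le>
           B * (norm (gauss_coeff a b d n) / norm (of_nat n + M))"
proof -
  have "norm (gauss_coeff a b c n) * norm z ^ n \<le> B * norm (gauss_coeff a b d n) * 1"
    using assms by (intro mult_mono) (auto intro: power_le_one order_trans[OF norm_ge_zero])
  thus ?thesis
    by (simp add: norm_mult norm_divide norm_power divide_right_mono)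
qed

lemma moment_series_sums:
  assumes "c \<notin> \<int>\<^sub>\<le>\<^sub>0" "Re (c - a - b) > -1" "Re M > 0" "norm z \<le> 1"
  shows "(\<lambda>n. gauss_coeff a b c n * z ^ n / (of_nat n + M)) sums moment_series z M a b c"
  unfolding moment_series_def
  using norm_moment_term_le[OF assms(4), of a b c _ 1 c M]
  by (intro summable_sums summable_comparison_test'[OF summable_gauss_coeff_over[OF assms(1-3)]]) simp

lemma continuous_on_moment_series:
  assumes "c \<notin> \<int>\<^sub>\<le>\<^sub>0" "Re (c - a - b) > -1" "Re M > 0"
  shows "continuous_on (cball 0 1) (\<lambda>z. moment_series z M a b c)"
proof (rule uniform_limit_theorem)
  show "uniform_limit (cball 0 1) (\<lambda>N z. \<Sum>n<N. gauss_coeff a b c n * z ^ n / (of_nat n + M))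
      (\<lambda>z. moment_series z M a b c) sequentially"
    unfolding moment_series_def
    using norm_moment_term_le[of _ a b c _ 1 c M]
    by (intro Weierstrass_m_test[OF _ summable_gauss_coeff_over[OF assms]]) auto
  show "\<forall>\<^sub>F N in sequentially. continuous_on (cball 0 1)
      (\<lambda>z. \<Sum>n<N. gauss_coeff a b c n * z ^ n / (of_nat n + M))"
    using add_of_nat_neq_0[OF Re_pos_not_nonpos_Ints[OF assms(3)]]
    by (auto intro!: always_eventually continuous_intros)
qed auto

lemma moment_recurrence_plus:
  assumes c: "c \<notin> \<int>\<^sub>\<le>\<^sub>0" and re: "Re (c - a - b) > -1" and M: "Re M > 0"
  shows "(M + 1 - a) * (M + 1 - b) * moment_series 1 (M + 1) a b c =
           M * (M + 1 - c) * moment_series 1 M a b c + E_plus a b c"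
proof -
  let ?u = "gauss_coeff a b c"
  let ?S = "\<lambda>M N. \<Sum>n<N. ?u n / (of_nat n + M)"
  have lim: "?S M \<longlonglongrightarrow> moment_series 1 M a b c" if "Re M > 0" for M
    using moment_series_sums[OF c re that, of 1] by (simp add: sums_def)
  have eq: "(M + 1 - a) * (M + 1 - b) * ?S (M + 1) N = M * (M + 1 - c) * ?S M (Suc N)
      + ((of_nat N * ?u N + (c - a - b) * (\<Sum>n<N. ?u n)) + (c - 1 - M) * ?u N)" for N
  proof -
    have "(\<Sum>n<N. ?u n * (of_nat n + c - 1 - M)) - (\<Sum>n<N. ?u n * (of_nat n + a + b - M - 1))
        = (c - a - b) * (\<Sum>n<N. ?u n)"
      by (simp add: sum_subtractf[symmetric] sum_distrib_left algebra_simps)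
    moreover have "(M + 1 - a) * (M + 1 - b) * ?S (M + 1) N = M * (M + 1 - c) * ?S M (Suc N)
        + (\<Sum>n<Suc N. ?u n * (of_nat n + c - 1 - M)) - (\<Sum>n<N. ?u n * (of_nat n + a + b - M - 1))"
      using moment_telescoping[OF c Re_pos_not_nonpos_Ints[OF M], of 1 a b N]
      by (simp del: sum.lessThan_Suc)
    moreover have "(\<Sum>n<Suc N. ?u n * (of_nat n + c - 1 - M)) =
        (\<Sum>n<N. ?u n * (of_nat n + c - 1 - M)) + ?u N * (of_nat N + c - 1 - M)"
      by simp
    moreover have "l = t + (w + v)" if "x0 - y = w" "l = t + x - y" "x = x0 + v" for l t x y w x0 v :: complex
      using that by (simp add: algebra_simps)
    ultimately have "(M + 1 - a) * (M + 1 - b) * ?S (M + 1) N = M * (M + 1 - c) * ?S M (Suc N)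
        + ((c - a - b) * (\<Sum>n<N. ?u n) + ?u N * (of_nat N + c - 1 - M))"
      by blast
    thus ?thesis by (simp only:) (simp add: algebra_simps del: sum.lessThan_Suc)
  qed
  have "(\<lambda>N. (M + 1 - a) * (M + 1 - b) * ?S (M + 1) N)
      \<longlonglongrightarrow> (M + 1 - a) * (M + 1 - b) * moment_series 1 (M + 1) a b c"
    by (intro tendsto_intros lim Re_add_1_pos M)
  moreover have "(\<lambda>N. M * (M + 1 - c) * ?S M (Suc N)
      + ((of_nat N * ?u N + (c - a - b) * (\<Sum>n<N. ?u n)) + (c - 1 - M) * ?u N))
      \<longlonglongrightarrow> M * (M + 1 - c) * moment_series 1 M a b c + (E_plus a b c + (c - 1 - M) * 0)"
    by (intro tendsto_intros LIMSEQ_Suc[OF lim[OF M]] gauss_coeff_partial_sum_tendsto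
          gauss_coeff_tendsto_0 c re)
  ultimately show ?thesis
    unfolding eq using LIMSEQ_unique by fastforce
qed

lemma gauss_series_deriv_sums:
  assumes c: "c \<notin> \<int>\<^sub>\<le>\<^sub>0" and z: "z \<in> ball 0 1"
  shows "(\<lambda>n. gauss_coeff a b c n * z ^ n * of_nat n) sums (z * deriv (hyp2F1 a b c) z)"
proof -
  note hyp = hyp2F1_continuation(2)[OF c, where a = a and b = b]
  define P where "P = Abs_fps (gauss_coeff a b c)"
  have rad: "fps_conv_radius P \<ge> 1"
    unfolding fps_conv_radius_def
  proof (rule conv_radius_geI_ex')
    fix r :: real assume "0 < r" "ereal r < 1"
    thus "summable (\<lambda>n. P $ n * of_real r ^ n)"
      using sums_summable[OF hyp[of "of_real r"]] by (simp add: P_def)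
  qed
  hence rad': "ereal (norm w) < fps_conv_radius P" if "w \<in> ball 0 1" for w
    using that by (metis ereal_less(3) less_le_trans mem_ball_0)
  have eval: "eval_fps P w = hyp2F1 a b c w" if "w \<in> ball 0 1" for w
    using sums_unique2[OF sums_eval_fps[OF rad'[OF that]]] hyp[OF that] by (simp add: P_def)
  have "(\<lambda>n. fps_deriv P $ n * z ^ n) sums eval_fps (fps_deriv P) z"
    using rad'[OF z] fps_conv_radius_deriv[of P] by (intro sums_eval_fps) (rule less_le_trans)
  also have "eval_fps (fps_deriv P) z = deriv (eval_fps P) z"
    by (rule eval_fps_deriv[OF rad'[OF z]])
  also have "\<dots> = deriv (hyp2F1 a b c) z"
    using z eval by (intro deriv_cong_ev eventually_mono[OF eventually_nhds_in_open[of "ball 0 1"]]) auto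
  finally have "(\<lambda>n. z * (fps_deriv P $ n * z ^ n)) sums (z * deriv (hyp2F1 a b c) z)"
    by (rule sums_mult)
  also have "(\<lambda>n. z * (fps_deriv P $ n * z ^ n)) = (\<lambda>n. gauss_coeff a b c (Suc n) * z ^ Suc n * of_nat (Suc n))"
    by (simp add: P_def fun_eq_iff mult_ac)
  finally show ?thesis
    by (subst (asm) sums_Suc_iff) simp
qed

text \<open>
  The limit of \<open>moment_telescoping\<close>, with \<open>\<Sum>n. u\<^sub>n z\<^sup>n = f(z)\<close> and \<open>\<Sum>n. n u\<^sub>n z\<^sup>n = z f'(z)\<close>.
\<close>
lemma moment_recurrence_disc:
  assumes c: "c \<notin> \<int>\<^sub>\<le>\<^sub>0" and re: "Re (c - a - b) > -1" and M: "Re M > 0" and z: "z \<in> ball 0 1"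
  shows "z * (M + 1 - a) * (M + 1 - b) * moment_series z (M + 1) a b c =
           M * (M + 1 - c) * moment_series z M a b c
           + ((c - 1 - M) - z * (a + b - M - 1)) * hyp2F1 a b c z
           + (1 - z) * (z * deriv (hyp2F1 a b c) z)"
proof -
  let ?t = "\<lambda>n. gauss_coeff a b c n * z ^ n"
  let ?S = "\<lambda>M N. \<Sum>n<N. ?t n / (of_nat n + M)"
  let ?f = "hyp2F1 a b c z" and ?g = "z * deriv (hyp2F1 a b c) z"
  have lim: "?S M \<longlonglongrightarrow> moment_series z M a b c" if "Re M > 0" for M
    using moment_series_sums[OF c re that, of z] z by (simp add: sums_def)
  have lin: "(\<lambda>N. \<Sum>n<N. ?t n * (of_nat n + d)) \<longlonglongrightarrow> ?g + ?f * d" for d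
    using sums_add[OF gauss_series_deriv_sums[OF c z, of a b] sums_mult2[OF hyp2F1_continuation(2)[OF c z, of a b], of d]]
    by (simp add: sums_def distrib_left)
  have "(\<lambda>N. z * (M + 1 - a) * (M + 1 - b) * ?S (M + 1) N)
      \<longlonglongrightarrow> z * (M + 1 - a) * (M + 1 - b) * moment_series z (M + 1) a b c"
    by (intro tendsto_intros lim Re_add_1_pos M)
  moreover have "(\<lambda>N. M * (M + 1 - c) * ?S M (Suc N) + (\<Sum>n<Suc N. ?t n * (of_nat n + (c - 1 - M)))
        - z * (\<Sum>n<N. ?t n * (of_nat n + (a + b - M - 1))))
      \<longlonglongrightarrow> M * (M + 1 - c) * moment_series z M a b c + (?g + ?f * (c - 1 - M))
           - z * (?g + ?f * (a + b - M - 1))"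
    by (intro tendsto_intros LIMSEQ_Suc[OF lim[OF M]] LIMSEQ_Suc[OF lin] lin)
  moreover have "z * (M + 1 - a) * (M + 1 - b) * ?S (M + 1) N =
      M * (M + 1 - c) * ?S M (Suc N) + (\<Sum>n<Suc N. ?t n * (of_nat n + (c - 1 - M)))
        - z * (\<Sum>n<N. ?t n * (of_nat n + (a + b - M - 1)))" for N
    using moment_telescoping[OF c Re_pos_not_nonpos_Ints[OF M], of z a b N]
    by (simp add: add_diff_eq add.assoc)
  ultimately have "z * (M + 1 - a) * (M + 1 - b) * moment_series z (M + 1) a b c =
      M * (M + 1 - c) * moment_series z M a b c + (?g + ?f * (c - 1 - M)) - z * (?g + ?f * (a + b - M - 1))"
    using LIMSEQ_unique by fastforce
  thus ?thesis by (simp add: algebra_simps)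
qed

text \<open>
  Both sides of the identity in the disc are continuous on the segment from \<open>-1\<close> to \<open>0\<close>, and they
  agree on its interior. This replaces the sum with terms of order \<open>n\<^sup>a\<^sup>+\<^sup>b\<^sup>-\<^sup>c\<close>, which may diverge at
  \<open>z = -1\<close>, by its Abel limit.
\<close>
lemma moment_recurrence_minus:
  assumes c: "c \<notin> \<int>\<^sub>\<le>\<^sub>0" and re: "Re (c - a - b) > -1" and M: "Re M > 0"
  shows "(-1) * (M + 1 - a) * (M + 1 - b) * moment_series (-1) (M + 1) a b c =
           M * (M + 1 - c) * moment_series (-1) M a b c + E_minus M a b c"
proof -
  define d where "d z = z * (M + 1 - a) * (M + 1 - b) * moment_series z (M + 1) a b c
     - (M * (M + 1 - c) * moment_series z M a b c
           + ((c - 1 - M) - z * (a + b - M - 1)) * hyp2F1 a b c z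
           + (1 - z) * (z * deriv (hyp2F1 a b c) z))" for z
  let ?I = "closed_segment (-1) (0 :: complex)"
  have I: "?I \<subseteq> cball 0 1" "?I \<subseteq> slit_plane"
  proof -
    show "?I \<subseteq> cball 0 1" by (intro closed_segment_subset) auto
    show "?I \<subseteq> slit_plane"
    proof
      fix z assume "z \<in> ?I"
      then obtain u where u: "0 \<le> u" "u \<le> 1" "z = (1 - u) *\<^sub>R (-1) + u *\<^sub>R 0"
        unfolding closed_segment_def by blast
      hence "Re z \<le> 0" by simp
      thus "z \<in> slit_plane" by (auto simp: slit_plane_def)
    qed
  qed
  have cl: "closure (open_segment (-1) (0 :: complex)) = ?I"
    by (subst closure_open_segment) simp
  have cont: "continuous_on ?I (hyp2F1 a b c)" "continuous_on ?I (deriv (hyp2F1 a b c))"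
    by (intro continuous_on_subset[OF _ I(2)] holomorphic_on_imp_continuous_on holomorphic_deriv
          hyp2F1_continuation(1)[OF c] open_slit_plane)+
  have cont': "continuous_on ?I (\<lambda>z. moment_series z M a b c)"
      "continuous_on ?I (\<lambda>z. moment_series z (M + 1) a b c)"
    by (intro continuous_on_subset[OF continuous_on_moment_series I(1)] c re M Re_add_1_pos)+
  have "d (-1) = 0"
  proof (rule continuous_constant_on_closure[where f = d and S = "open_segment (-1) 0"])
    show "continuous_on (closure (open_segment (-1) 0)) d"
      unfolding d_def cl by (intro continuous_intros cont cont')
    show "d z = 0" if "z \<in> open_segment (-1) 0" for z
    proof -
      obtain u where u: "0 < u" "u < 1" "z = (1 - u) *\<^sub>R (-1) + u *\<^sub>R 0"
        using \<open>z \<in> open_segment (-1) 0\<close> unfolding in_segment by blast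
      have "norm z = 1 - u" using u by simp
      hence "z \<in> ball 0 1" using u(1) by simp
      from moment_recurrence_disc[OF c re M this] show ?thesis by (simp add: d_def)
    qed
    show "-1 \<in> closure (open_segment (-1) (0 :: complex))"
      unfolding cl by simp
  qed
  hence "(-1) * (M + 1 - a) * (M + 1 - b) * moment_series (-1) (M + 1) a b c =
      M * (M + 1 - c) * moment_series (-1) M a b c
           + ((c - 1 - M) - (-1) * (a + b - M - 1)) * hyp2F1 a b c (-1)
           + (1 - (-1)) * ((-1) * deriv (hyp2F1 a b c) (-1))"
    unfolding d_def by (simp only: right_minus_eq)
  moreover have "(c - 1 - M) - (-1) * (a + b - M - 1) = c + a + b - 2 * M - 2"
    by simp
  moreover have "(1 - (-1)) * ((-1) * deriv (hyp2F1 a b c) (-1)) = - (2 * deriv (hyp2F1 a b c) (-1))"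
    by simp
  ultimately show ?thesis
    unfolding E_minus_def by (simp only: diff_conv_add_uminus add.assoc)
qed

lemma moment_recurrence:
  assumes "\<epsilon> \<in> {1, -1}" "c \<notin> \<int>\<^sub>\<le>\<^sub>0" "Re (c - a - b) > -1" "Re M > 0"
  shows "\<epsilon> * (M + 1 - a) * (M + 1 - b) * moment_series \<epsilon> (M + 1) a b c =
           M * (M + 1 - c) * moment_series \<epsilon> M a b c + E_fun \<epsilon> M a b c"
proof (cases "\<epsilon> = 1")
  case True
  thus ?thesis using moment_recurrence_plus[OF assms(2-4)] by (simp add: E_fun_def)
next
  case False
  hence "\<epsilon> = -1" using assms(1) by simp
  moreover have "E_fun (-1) M a b c = E_minus M a b c" by (simp add: E_fun_def)
  ultimately show ?thesis
    using moment_recurrence_minus[OF assms(2-4)] by (simp only:)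
qed

section \<open>Differentiation in the lower parameter\<close>

definition parameter_domain :: "complex \<Rightarrow> complex \<Rightarrow> complex set" where
  "parameter_domain a b = {c. Re (c - a - b) > -1} - \<int>\<^sub>\<le>\<^sub>0"

lemma open_parameter_domain: "open (parameter_domain a b)"
  unfolding parameter_domain_def
  by (intro open_Diff closed_nonpos_Ints open_Collect_less continuous_intros)

text \<open>
  Near \<open>c\<close> the terms are dominated, up to a constant, by those at a real parameter \<open>x\<close> that still
  satisfies \<open>Re (x - a - b) > -1\<close>.
\<close>
lemma moment_series_uniform_limit:
  assumes c: "c \<in> parameter_domain a b" and M: "Re M > 0" and z: "norm z \<le> 1"
  obtains \<delta> where "\<delta> > 0" "ball c \<delta> \<subseteq> parameter_domain a b"
    "uniform_limit (ball c \<delta>) (\<lambda>N d. \<Sum>n<N. gauss_coeff a b d n * z ^ n / (of_nat n + M))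
       (moment_series z M a b) sequentially"
proof -
  \<comment> \<open>there is no integer strictly between \<open>\<lceil>Re c\<rceil> - 1\<close> and \<open>Re c\<close>, so \<open>x\<close> is not a pole\<close>
  have "max (Re (a + b) - 1) (of_int (\<lceil>Re c\<rceil> - 1)) < Re c"
    using c unfolding parameter_domain_def by simp linarith
  then obtain x where x: "max (Re (a + b) - 1) (of_int (\<lceil>Re c\<rceil> - 1)) < x" "x < Re c"
    using dense by blast
  have xZ: "complex_of_real x \<notin> \<int>\<^sub>\<le>\<^sub>0"
  proof
    assume "complex_of_real x \<in> \<int>\<^sub>\<le>\<^sub>0"
    then obtain k where "complex_of_real x = - of_nat k" by (elim nonpos_Ints_cases')
    hence k: "x = of_int (- int k)" by (simp add: complex_eq_iff)
    have "real_of_int (\<lceil>Re c\<rceil> - 1) < of_int (- int k)"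
      using x(1) unfolding k by (simp only: max_less_iff_conj)
    hence "\<lceil>Re c\<rceil> \<le> - int k" by (simp only: of_int_less_iff)
    hence "Re c \<le> x" unfolding k by (simp only: ceiling_le_iff)
    thus False using x(2) by simp
  qed
  have xre: "Re (of_real x - a - b) > -1" using x by simp
  obtain \<delta> B where \<delta>: "\<delta> > 0" "ball c \<delta> \<subseteq> - \<int>\<^sub>\<le>\<^sub>0" and
    B: "\<And>w n. w \<in> ball c \<delta> \<Longrightarrow> norm (pochhammer (of_real x :: complex) n) \<le> B * norm (pochhammer w n)"
    using pochhammer_locally_dominated[of c x] c x(2) by (auto simp: parameter_domain_def)
  obtain e where e: "e > 0" "ball c e \<subseteq> parameter_domain a b"
    using open_parameter_domain c by (meson open_contains_ball)
  show ?thesis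
  proof (rule that[of "min \<delta> e"])
    show "ball c (min \<delta> e) \<subseteq> parameter_domain a b" using e by auto
    show "uniform_limit (ball c (min \<delta> e)) (\<lambda>N d. \<Sum>n<N. gauss_coeff a b d n * z ^ n / (of_nat n + M))
       (moment_series z M a b) sequentially"
      unfolding moment_series_def
    proof (rule Weierstrass_m_test)
      show "summable (\<lambda>n. B * (norm (gauss_coeff a b (of_real x) n) / norm (of_nat n + M)))"
        by (intro summable_mult summable_gauss_coeff_over xZ xre M)
      fix n d assume "d \<in> ball c (min \<delta> e)"
      hence d: "d \<in> ball c \<delta>" by simp
      thus "norm (gauss_coeff a b d n * z ^ n / (of_nat n + M))
          \<le> B * (norm (gauss_coeff a b (of_real x) n) / norm (of_nat n + M))"
        using \<delta>(2) by (intro norm_moment_term_le z norm_gauss_coeff_le B xZ) auto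
    qed
  qed (use \<delta> e in auto)
qed

lemma inverse_pochhammer_holomorphic:
  "(\<lambda>c. 1 / pochhammer c n) holomorphic_on (- \<int>\<^sub>\<le>\<^sub>0 :: complex set)"
proof -
  have "(\<lambda>c :: complex. pochhammer c n) holomorphic_on - \<int>\<^sub>\<le>\<^sub>0"
    unfolding pochhammer_prod by (intro holomorphic_intros)
  thus ?thesis by (intro holomorphic_intros) (auto simp: pochhammer_neq_0)
qed

lemma gauss_coeff_term_holomorphic:
  "(\<lambda>c. gauss_coeff a b c n * z ^ n / (of_nat n + M)) holomorphic_on - \<int>\<^sub>\<le>\<^sub>0"
proof -
  have "(\<lambda>c. pochhammer a n * pochhammer b n * z ^ n / (fact n * (of_nat n + M)) * (1 / pochhammer c n))
      holomorphic_on - \<int>\<^sub>\<le>\<^sub>0"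
    by (intro holomorphic_on_mult holomorphic_on_const inverse_pochhammer_holomorphic)
  thus ?thesis by (simp add: gauss_coeff_def mult_ac)
qed

lemma moment_series_holomorphic:
  assumes M: "Re M > 0" and z: "norm z \<le> 1"
  shows "moment_series z M a b holomorphic_on parameter_domain a b"
proof -
  have "\<exists>e>0. moment_series z M a b holomorphic_on ball c e" if c: "c \<in> parameter_domain a b" for c
  proof -
    obtain \<delta> where \<delta>: "\<delta> > 0" "ball c \<delta> \<subseteq> parameter_domain a b" and
      lim: "uniform_limit (ball c \<delta>) (\<lambda>N d. \<Sum>n<N. gauss_coeff a b d n * z ^ n / (of_nat n + M))
              (moment_series z M a b) sequentially"
      by (rule moment_series_uniform_limit[OF c M z])
    have sub1: "cball c (\<delta> / 2) \<subseteq> ball c \<delta>"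
      using \<delta>(1) by auto
    have "parameter_domain a b \<subseteq> - \<int>\<^sub>\<le>\<^sub>0" by (auto simp: parameter_domain_def)
    hence sub2: "cball c (\<delta> / 2) \<subseteq> - \<int>\<^sub>\<le>\<^sub>0"
      using sub1 \<delta>(2) by blast
    have hol: "(\<lambda>d. \<Sum>n<N. gauss_coeff a b d n * z ^ n / (of_nat n + M)) holomorphic_on cball c (\<delta> / 2)" for N
      by (intro holomorphic_on_sum holomorphic_on_subset[OF gauss_coeff_term_holomorphic sub2])
    have "moment_series z M a b holomorphic_on ball c (\<delta> / 2)"
    proof (rule holomorphic_uniform_limit[OF _ uniform_limit_on_subset[OF lim sub1]])
      show "\<forall>\<^sub>F N in sequentially.
          continuous_on (cball c (\<delta> / 2)) (\<lambda>d. \<Sum>n<N. gauss_coeff a b d n * z ^ n / (of_nat n + M)) \<and>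
          (\<lambda>d. \<Sum>n<N. gauss_coeff a b d n * z ^ n / (of_nat n + M)) holomorphic_on ball c (\<delta> / 2)"
        by (intro always_eventually allI conjI holomorphic_on_imp_continuous_on hol
              holomorphic_on_subset[OF hol ball_subset_cball])
    qed auto
    thus ?thesis using \<delta>(1) by (intro exI[of _ "\<delta> / 2"]) auto
  qed
  thus ?thesis
    using open_parameter_domain
    by (metis analytic_on_def analytic_on_open)
qed

text \<open>
  By locally uniform convergence the derivatives of the plain moment may be computed term by term.
\<close>
lemma harmonic_moment_sums:
  assumes c: "c \<in> parameter_domain a b" and M: "Re (of_nat m + 1 + lam) > 0" and z: "norm z \<le> 1"
  shows "harmonic_moment_term m r z lam a b c sums
           ((-1) ^ r * (deriv ^^ r) (moment_series z (of_nat m + 1 + lam) a b) c)"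
proof -
  let ?M = "of_nat m + 1 + lam"
  let ?f = "\<lambda>n d. gauss_coeff a b d n * z ^ n / (of_nat n + ?M)"
  obtain \<delta> where \<delta>: "\<delta> > 0" "ball c \<delta> \<subseteq> parameter_domain a b" and
    lim: "uniform_limit (ball c \<delta>) (\<lambda>N d. \<Sum>n<N. ?f n d) (moment_series z ?M a b) sequentially"
    by (rule moment_series_uniform_limit[OF c M z])
  have sub: "ball c \<delta> \<subseteq> - \<int>\<^sub>\<le>\<^sub>0" using \<delta>(2) by (auto simp: parameter_domain_def)
  have cb: "c \<in> ball c \<delta>" using \<delta>(1) by simp
  have cZ: "c \<notin> \<int>\<^sub>\<le>\<^sub>0" using c by (simp add: parameter_domain_def)
  have hol: "?f n holomorphic_on ball c \<delta>" for n
    using gauss_coeff_term_holomorphic sub by (rule holomorphic_on_subset)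
  have "(\<lambda>N. (deriv ^^ r) (\<lambda>d. \<Sum>n<N. ?f n d) c) \<longlonglongrightarrow> (deriv ^^ r) (moment_series z ?M a b) c"
    by (rule higher_deriv_complex_uniform_limit[OF lim])
       (auto intro!: always_eventually holomorphic_intros hol cb \<delta>(1))
  also have "(\<lambda>N. (deriv ^^ r) (\<lambda>d. \<Sum>n<N. ?f n d) c) = (\<lambda>N. \<Sum>n<N. (deriv ^^ r) (?f n) c)"
  proof
    fix N
    show "(deriv ^^ r) (\<lambda>d. \<Sum>n<N. ?f n d) c = (\<Sum>n<N. (deriv ^^ r) (?f n) c)"
    proof (induction N)
      case (Suc N)
      show ?case
        using higher_deriv_add[OF _ hol, of "\<lambda>d. \<Sum>n<N. ?f n d" c r N] cb Suc
        by (simp add: hol holomorphic_intros)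
    qed simp
  qed
  finally have "(\<lambda>n. (deriv ^^ r) (?f n) c) sums (deriv ^^ r) (moment_series z ?M a b) c"
    by (simp add: sums_def)
  hence "(\<lambda>n. (-1) ^ r * (deriv ^^ r) (?f n) c) sums ((-1) ^ r * (deriv ^^ r) (moment_series z ?M a b) c)"
    by (rule sums_mult)
  moreover have "(-1) ^ r * (deriv ^^ r) (?f n) c = harmonic_moment_term m r z lam a b c n" for n
  proof -
    let ?C = "z ^ n * pochhammer a n * pochhammer b n / (fact n * (of_nat n + ?M))"
    have "(deriv ^^ r) (?f n) c = (deriv ^^ r) (\<lambda>d. ?C * (1 / pochhammer d n)) c"
      by (simp add: gauss_coeff_def mult_ac)
    also have "\<dots> = ?C * (deriv ^^ r) (\<lambda>d. 1 / pochhammer d n) c"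
      using cZ by (intro higher_deriv_cmult[OF inverse_pochhammer_holomorphic]) (auto simp: open_Compl)
    finally have "(-1) ^ r * (deriv ^^ r) (?f n) c =
        ?C * ((-1) ^ r * (deriv ^^ r) (\<lambda>d. 1 / pochhammer d n) c)"
      by (simp add: mult_ac)
    also have "\<dots> = harmonic_moment_term m r z lam a b c n"
      unfolding higher_deriv_inverse_pochhammer[OF cZ]
      by (simp add: harmonic_moment_term_def add_ac mult_ac)
    finally show ?thesis .
  qed
  ultimately show ?thesis by simp
qed

text \<open>
  For \<open>r = 0\<close> the second term vanishes through its factor \<open>r\<close>.
\<close>
lemma higher_deriv_linear_factor:
  assumes f: "f holomorphic_on S" and S: "open S" "z \<in> S"
  shows "(deriv ^^ r) (\<lambda>w. (d - w) * f w) z =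
           (d - z) * (deriv ^^ r) f z - of_nat r * (deriv ^^ (r - 1)) f z"
  using S(2)
proof (induction r arbitrary: z)
  case (Suc r)
  have df: "((deriv ^^ k) f has_field_derivative (deriv ^^ Suc k) f z) (at z)" for k
    by (rule has_field_derivative_higher_deriv[OF f S(1) Suc.prems])
  have "((\<lambda>w. (d - w) * (deriv ^^ r) f w - of_nat r * (deriv ^^ (r - 1)) f w) has_field_derivative
      (d - z) * (deriv ^^ Suc r) f z - of_nat (Suc r) * (deriv ^^ r) f z) (at z)"
  proof (cases r)
    case 0
    thus ?thesis using df[of 0] by (auto intro!: derivative_eq_intros)
  next
    case (Suc k)
    show ?thesis using df[of r] df[of k] unfolding Suc
      by (auto intro!: derivative_eq_intros simp: algebra_simps simp del: funpow.simps)
  qed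
  hence "((deriv ^^ r) (\<lambda>w. (d - w) * f w) has_field_derivative
      (d - z) * (deriv ^^ Suc r) f z - of_nat (Suc r) * (deriv ^^ r) f z) (at z)"
    by (rule has_field_derivative_transform_within_open[OF _ S(1) Suc.prems]) (simp add: Suc.IH)
  thus ?case by (simp add: DERIV_imp_deriv)
qed simp

text \<open>
  The logarithmic derivative of the Gamma quotient is \<open>Delta_psi 1\<close>, and differentiating
  \<open>Delta_psi j\<close> gives \<open>Delta_psi (j + 1)\<close>.
\<close>
lemma higher_deriv_E_plus:
  assumes "c0 \<notin> \<int>\<^sub>\<le>\<^sub>0" "c0 - a - b + 1 \<notin> \<int>\<^sub>\<le>\<^sub>0" "c0 - a \<notin> \<int>\<^sub>\<le>\<^sub>0" "c0 - b \<notin> \<int>\<^sub>\<le>\<^sub>0"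
  shows "(deriv ^^ r) (E_plus a b) c0 = E_plus a b c0 * bell_complete r (\<lambda>j. Delta_psi j a b c0)"
proof -
  define S where "S = - \<int>\<^sub>\<le>\<^sub>0 \<inter> (\<lambda>c. c - a - b + 1) -` (- \<int>\<^sub>\<le>\<^sub>0)
      \<inter> (\<lambda>c. c - a) -` (- \<int>\<^sub>\<le>\<^sub>0) \<inter> (\<lambda>c. c - b) -` (- \<int>\<^sub>\<le>\<^sub>0)"
  have S: "open S" "c0 \<in> S"
    using assms unfolding S_def
    by (auto intro!: open_Int open_vimage continuous_intros simp: open_Compl)
  define L where "L j c = Delta_psi (Suc j) a b c" for j c
  have shift: "((\<lambda>c. c - a - b + 1) has_field_derivative 1) (at w)"
    "((\<lambda>c. c - a) has_field_derivative 1) (at w)" "((\<lambda>c. c - b) has_field_derivative 1) (at w)" for w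
    by (auto intro!: derivative_eq_intros)
  have dE: "(E_plus a b has_field_derivative E_plus a b w * L 0 w) (at w)" if "w \<in> S" for w
  proof -
    have w: "w \<notin> \<int>\<^sub>\<le>\<^sub>0" "w - a - b + 1 \<notin> \<int>\<^sub>\<le>\<^sub>0" "w - a \<notin> \<int>\<^sub>\<le>\<^sub>0" "w - b \<notin> \<int>\<^sub>\<le>\<^sub>0"
      using that by (auto simp: S_def)
    have d1: "(Gamma has_field_derivative Gamma w * Digamma w) (at w)"
      using w by (intro has_field_derivative_Gamma)
    have d2: "((\<lambda>c. Gamma (c - a - b + 1)) has_field_derivative
        Gamma (w - a - b + 1) * Digamma (w - a - b + 1)) (at w)"
      using DERIV_chain2[OF has_field_derivative_Gamma[OF w(2)] shift(1)] by simp
    have d3: "((\<lambda>c. rGamma (c - a)) has_field_derivative - rGamma (w - a) * Digamma (w - a)) (at w)"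
      using DERIV_chain2[OF has_field_derivative_rGamma_no_nonpos_int[OF w(3)] shift(2)] by simp
    have d4: "((\<lambda>c. rGamma (c - b)) has_field_derivative - rGamma (w - b) * Digamma (w - b)) (at w)"
      using DERIV_chain2[OF has_field_derivative_rGamma_no_nonpos_int[OF w(4)] shift(3)] by simp
    have "((\<lambda>c. Gamma c * Gamma (c - a - b + 1) * rGamma (c - a) * rGamma (c - b))
        has_field_derivative E_plus a b w * L 0 w) (at w)"
      by (rule DERIV_cong[OF DERIV_mult[OF DERIV_mult[OF DERIV_mult[OF d1 d2] d3] d4]])
         (simp add: E_plus_def L_def Delta_psi_def algebra_simps)
    thus ?thesis by (simp add: E_plus_def[abs_def])
  qed
  have dL: "(L j has_field_derivative L (Suc j) w) (at w)" if "w \<in> S" for j w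
  proof -
    have w: "w \<notin> \<int>\<^sub>\<le>\<^sub>0" "w - a - b + 1 \<notin> \<int>\<^sub>\<le>\<^sub>0" "w - a \<notin> \<int>\<^sub>\<le>\<^sub>0" "w - b \<notin> \<int>\<^sub>\<le>\<^sub>0"
      using that by (auto simp: S_def)
    have "((\<lambda>c. Polygamma j c + Polygamma j (c - a - b + 1) - Polygamma j (c - a) - Polygamma j (c - b))
       has_field_derivative Polygamma (Suc j) w * 1 + Polygamma (Suc j) (w - a - b + 1) * 1
         - Polygamma (Suc j) (w - a) * 1 - Polygamma (Suc j) (w - b) * 1) (at w)"
      using w by (intro DERIV_diff DERIV_add DERIV_chain2[OF has_field_derivative_Polygamma]
          shift DERIV_ident)
    thus ?thesis by (simp add: L_def[abs_def] Delta_psi_def)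
  qed
  have "(deriv ^^ r) (E_plus a b) c0 = E_plus a b c0 * bell_complete r (\<lambda>j. L (j - 1) c0)"
    by (rule higher_deriv_log_derivative[OF S dE dL])
  thus ?thesis by (simp add: L_def Delta_psi_def)
qed

text \<open>
  The recurrence for \<open>r = 0\<close> expresses \<open>E_fun\<close> through moments on the whole domain. In
  particular \<open>E_fun\<close> is holomorphic in \<open>c\<close> there, also for \<open>\<epsilon> = -1\<close>, and its derivatives are
  obtained from those of the moments.
\<close>
lemma harmonic_moment_recurrence:
  fixes \<epsilon> a b c0 M :: complex
  assumes \<epsilon>: "\<epsilon> \<in> {1, -1}" and c: "c0 \<in> parameter_domain a b" and M: "Re M > 0"
  defines "\<Psi> \<equiv> (\<lambda>r M. (-1) ^ r * (deriv ^^ r) (moment_series \<epsilon> M a b) c0)"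
  shows "\<epsilon> * (M + 1 - a) * (M + 1 - b) * \<Psi> r (M + 1) =
           M * (M + 1 - c0) * \<Psi> r M + (if r = 0 then 0 else of_nat r * M * \<Psi> (r - 1) M)
           + E_deriv \<epsilon> r M a b c0"
proof -
  let ?S = "parameter_domain a b"
  let ?F = "moment_series \<epsilon> M a b" and ?G = "moment_series \<epsilon> (M + 1) a b"
  let ?A = "\<epsilon> * (M + 1 - a) * (M + 1 - b)"
  have S: "open ?S" by (rule open_parameter_domain)
  have n: "norm \<epsilon> \<le> 1" using \<epsilon> by auto
  have hol: "?F holomorphic_on ?S" "?G holomorphic_on ?S"
    using M n by (auto intro!: moment_series_holomorphic)
  have holQ: "(\<lambda>c. ?A * ?G c - M * ((M + 1 - c) * ?F c)) holomorphic_on ?S"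
    by (intro holomorphic_intros hol)
  have E: "E_fun \<epsilon> M a b c = ?A * ?G c - M * ((M + 1 - c) * ?F c)" if "c \<in> ?S" for c
    using moment_recurrence[OF \<epsilon> _ _ M, of c a b] that
    by (simp add: parameter_domain_def algebra_simps)
  have "(deriv ^^ r) (\<lambda>c. E_fun \<epsilon> M a b c) c0 =
      (deriv ^^ r) (\<lambda>c. ?A * ?G c - M * ((M + 1 - c) * ?F c)) c0"
    using E holomorphic_transform[OF holQ]
    by (intro higher_deriv_transform_within_open[OF _ holQ S c]) auto
  also have "\<dots> = ?A * (deriv ^^ r) ?G c0 - M * ((M + 1 - c0) * (deriv ^^ r) ?F c0
      - of_nat r * (deriv ^^ (r - 1)) ?F c0)"
    by (subst higher_deriv_diff[OF _ _ S c], intro holomorphic_intros hol, intro holomorphic_intros hol)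
       (simp add: higher_deriv_cmult[OF _ c S] higher_deriv_linear_factor[OF hol(1) S c] hol holomorphic_intros)
  finally have "E_deriv \<epsilon> r M a b c0 = (-1) ^ r * (?A * (deriv ^^ r) ?G c0
      - M * ((M + 1 - c0) * (deriv ^^ r) ?F c0 - of_nat r * (deriv ^^ (r - 1)) ?F c0))"
    by (simp add: E_deriv_def)
  thus ?thesis
    unfolding \<Psi>_def by (cases r) (simp_all add: algebra_simps del: funpow.simps)
qed

theorem theorem4p2:
  fixes \<epsilon> a b c0 lam M :: complex and r m :: nat
  assumes "\<epsilon> \<in> {1, -1}"
    and "m \<ge> 1"
    and "M = of_nat m + lam"
    and "Re M > 0"
    and "c0 \<notin> \<int>\<^sub>\<le>\<^sub>0"
    and "Re (c0 - a - b) > -1"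
  shows "(summable (harmonic_moment_term m r \<epsilon> lam a b c0) \<and>
          summable (harmonic_moment_term (m - 1) r \<epsilon> lam a b c0) \<and>
          (r \<noteq> 0 \<longrightarrow> summable (harmonic_moment_term (m - 1) (r - 1) \<epsilon> lam a b c0)) \<and>
          \<epsilon> * (M + 1 - a) * (M + 1 - b) * harmonic_moment m r \<epsilon> lam a b c0 =
            M * (M + 1 - c0) * harmonic_moment (m - 1) r \<epsilon> lam a b c0
            + (if r = 0 then 0
               else of_nat r * M * harmonic_moment (m - 1) (r - 1) \<epsilon> lam a b c0)
            + E_deriv \<epsilon> r M a b c0) \<and>
         (\<epsilon> = 1 \<and> c0 - a - b + 1 \<notin> \<int>\<^sub>\<le>\<^sub>0 \<and> c0 - a \<notin> \<int>\<^sub>\<le>\<^sub>0 \<and> c0 - b \<notin> \<int>\<^sub>\<le>\<^sub>0 \<longrightarrow>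
          E_deriv 1 r M a b c0 =
            (-1) ^ r * (Gamma c0 * Gamma (c0 - a - b + 1) / (Gamma (c0 - a) * Gamma (c0 - b)))
              * bell_complete r (\<lambda>j. Delta_psi j a b c0))"
proof -
  have c: "c0 \<in> parameter_domain a b"
    using assms(5,6) by (simp add: parameter_domain_def)
  have n: "norm \<epsilon> \<le> 1" using assms(1) by auto
  have M: "of_nat m + 1 + lam = M + 1" "of_nat (m - 1) + 1 + lam = M"
    using assms(2,3) by (simp_all add: of_nat_diff)
  have sums_m: "harmonic_moment_term m k \<epsilon> lam a b c0 sums
      ((-1) ^ k * (deriv ^^ k) (moment_series \<epsilon> (M + 1) a b) c0)" for k
    using harmonic_moment_sums[OF c _ n, of m lam k] assms(4) unfolding M by simp
  have sums_m1: "harmonic_moment_term (m - 1) k \<epsilon> lam a b c0 sums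
      ((-1) ^ k * (deriv ^^ k) (moment_series \<epsilon> M a b) c0)" for k
    using harmonic_moment_sums[OF c _ n, of "m - 1" lam k] assms(4) unfolding M by simp
  have val: "harmonic_moment m k \<epsilon> lam a b c0 = (-1) ^ k * (deriv ^^ k) (moment_series \<epsilon> (M + 1) a b) c0"
    "harmonic_moment (m - 1) k \<epsilon> lam a b c0 = (-1) ^ k * (deriv ^^ k) (moment_series \<epsilon> M a b) c0" for k
    unfolding harmonic_moment_def using sums_m sums_m1 by (simp_all add: sums_iff)
  have plus: "E_deriv 1 r M a b c0 =
            (-1) ^ r * (Gamma c0 * Gamma (c0 - a - b + 1) / (Gamma (c0 - a) * Gamma (c0 - b)))
              * bell_complete r (\<lambda>j. Delta_psi j a b c0)"
    if "c0 - a - b + 1 \<notin> \<int>\<^sub>\<le>\<^sub>0" "c0 - a \<notin> \<int>\<^sub>\<le>\<^sub>0" "c0 - b \<notin> \<int>\<^sub>\<le>\<^sub>0"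
  proof -
    have "E_deriv 1 r M a b c0 = (-1) ^ r * (deriv ^^ r) (E_plus a b) c0"
      by (simp add: E_deriv_def E_fun_def)
    also have "E_plus a b c0 = Gamma c0 * Gamma (c0 - a - b + 1) / (Gamma (c0 - a) * Gamma (c0 - b))"
      by (simp add: E_plus_def rGamma_inverse_Gamma divide_inverse)
    hence "(deriv ^^ r) (E_plus a b) c0 = Gamma c0 * Gamma (c0 - a - b + 1) / (Gamma (c0 - a) * Gamma (c0 - b))
        * bell_complete r (\<lambda>j. Delta_psi j a b c0)"
      by (simp only: higher_deriv_E_plus[OF assms(5) that])
    finally show ?thesis by (simp only: mult.assoc)
  qed
  show ?thesis
    unfolding val
    by (intro conjI impI sums_summable[OF sums_m] sums_summable[OF sums_m1]
          harmonic_moment_recurrence[OF assms(1) c assms(4)] plus) blast+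
qed

end
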